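(* Let $M$ be a smooth manifold and let $\nabla$ be a torsion free complex covariant derivative operator acting on the smooth sections of the complexified tangent bundle $\mathbb{C}T_M$. Let $(S_k)_{k\geqslant2}$ be a family of tensors $S_k\in C^\infty(M,T_M^*\otimes_{\mathbb R}S^kT_M^*\otimes_{\mathbb R}\mathbb{C}T_M)$. Then $$S_k=\frac{i}{(k+1)!\,k!}\,\mathrm{Sym}_{2,\ldots,k+1}\Theta_k^\nabla\qquad\text{for all }k\geqslant2,$$ with $\Theta_2^\nabla:=2R^\nabla$ and $$\Theta_k^\nabla:=-2i\,(id_1^\nabla)^{k-3}(\nabla R^\nabla)_2+\sum_{r=3}^{k-1}(r+1)!\sum_{p=2}^{r-1}(id_1^\nabla)^{k-1-r}(p\,S_p\wedge_1S_{r-p+1})\qquad\text{for all }k\geqslant3,$$ if and only if $$S_k=\frac{i}{(k+1)!\,k!}\sum_{D\geqslant0,\ \|D\|=k}C_D\,\mathrm{Sym}_{2,\ldots,k+1}R^D\qquad\text{for all }k\geqslant2.$$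
   Context: **Tensor notation.** $R^\nabla(\cdot,\cdot)\cdot\equiv R^\nabla(\cdot,\cdot,\cdot)$ is the curvature of $\nabla$; $R^{(a)}:=\nabla^aR^\nabla$, the derivative directions being the first entries (the leftmost entry is the outermost derivative). Tensors with values in $\mathbb{C}T_M$ are extended complex multilinearly. $\mathrm{Sym}_{r_1,\ldots,r_s}$ is the sum over all permutations of the entries $r_1,\ldots,r_s$ (no normalizing coefficient). $\theta_2(v_1,v_2,\bullet):=\theta(v_2,v_1,\bullet)$. $d_1^\nabla A(\xi_1,\xi_2,\mu):=\nabla_{\xi_1}A(\xi_2,\mu)-\nabla_{\xi_2}A(\xi_1,\mu)$ for $A\in C^\infty(M,T_M^{*,\otimes k}\otimes\mathbb{C}T_M)$, $\mu\in T_M^{\oplus(k-1)}$, $k\ge1$. For $A$ with $k+1$ entries and $B$ with $l+1$ entries, $(A\wedge_1B)(\xi_1,\xi_2,\eta,\mu):=A(\xi_1,B(\xi_2,\eta),\mu)-A(\xi_2,B(\xi_1,\eta),\mu)$ with $\eta\in T_M^{\oplus l}$, $\mu\in T_M^{\oplus(k-1)}$. Empty sums are $0$, empty products are $1$. **Multi-indices, $R^D$ and $C_D$.** For $A=(a_1,\ldots,a_N)\in\mathbb{Z}_{\geqslant0}^N$, $N\geqslant1$: $l_A:=N$, $|A|:=\sum_ja_j$, $|A|_j:=\sum_{s=1}^ja_s$, $\|A\|_j:=|A|_j+j$ (so $|A|_0=\|A\|_0=0$), $\|A\|:=\|A\|_N+N=|A|+2N$; $A_l^-:=(a_1,\ldots,a_l)$,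 $A'_{l,h}:=(a_{l+1},\ldots,a_h)$; $A!=\prod_ja_j!$; inequalities are componentwise. The sum over $D\geqslant0$, $\|D\|=k$ runs over all $D\in\mathbb{Z}_{\geqslant0}^N$, all $N\geqslant1$, with $\|D\|=k$. Writing $1,2,\ldots$ for vectors $v_1,v_2,\ldots$, and $\prod_{j=1}^pT_j:=T_1\circ\cdots\circ T_p$ for endomorphisms, $$R^A(1,\ldots,\|A\|+1):=\Big[\prod_{j=1}^{l_A}R^{(a_j)}\big(\|A\|_{j-1}+2,\ldots,\|A\|_j+1,\bullet,\|A\|-j+2\big)\Big]\cdot1,$$ where $R^{(a)}(\ldots,\bullet,w)$ denotes the endomorphism $v\mapsto R^{(a)}(\ldots,v,w)$. $\lambda\vDash l$ means $\lambda\in\mathbb{Z}_{\geqslant1}^p$ for some $p\ge 1$ with $|\lambda|=l$ (and $l_\lambda=p$, $|\lambda|_j=\sum_{s\le j}\lambda_s$). For $A\in\mathbb{Z}^l_{\geqslant0}$, $$C_A:=-(-i)^{\|A\|}(\|A\|+1)!\sum_{0\leqslant H\leqslant A}\frac{(-1)^{|H|}C(H)}{H!(A-H)!}\quad(l_H=l),$$ $$C(H):=\sum_{\lambda\vDash l}(-1)^{l_\lambda}\|H_{\lambda_1}^-\|\prod_{j=1}^{l_\lambda}\prod_{s=|\lambda|_{j-1}}^{|\lambda|_j-1}\frac{1}{\|H'_{s,|\lambda|_j}\|\,(\|H'_{s,|\lambda|_j}\|+1)}.$$ *)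

theory Defs
  imports "HOL-Analysis.Analysis" "HOL-Combinatorics.Permutations" "HOL-Library.Function_Algebras"
begin

section \<open>Smooth manifolds\<close>

text \<open>
  The manifold is the whole type \<open>'a\<close>, with its Hausdorff, second countable topology, and a smooth
  atlas of charts into the library's \<open>\<real>\<^sup>n\<close>, \<^const>\<open>Euclidean_space\<close>; the case \<open>n = 0\<close> is allowed.
  \<open>Ck_on n k V f\<close> is only meant for \<open>V\<close> open in \<open>\<real>\<^sup>n\<close>.
\<close>

primrec Ck_on :: "nat \<Rightarrow> nat \<Rightarrow> (nat \<Rightarrow> real) set \<Rightarrow> ((nat \<Rightarrow> real) \<Rightarrow> 'b::real_normed_vector) \<Rightarrow> bool"
where
  "Ck_on n 0 V f \<longleftrightarrow> continuous_map (subtopology (Euclidean_space n) V) euclidean f"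
| "Ck_on n (Suc k) V f \<longleftrightarrow>
     continuous_map (subtopology (Euclidean_space n) V) euclidean f \<and>
     (\<forall>i<n. \<exists>g. Ck_on n k V g \<and>
        (\<forall>x\<in>V. ((\<lambda>t. f (x(i := t))) has_vector_derivative g x) (at (x i))))"

definition smooth_on :: "nat \<Rightarrow> (nat \<Rightarrow> real) set \<Rightarrow> ((nat \<Rightarrow> real) \<Rightarrow> 'b::real_normed_vector) \<Rightarrow> bool"
  where "smooth_on n V f \<longleftrightarrow> (\<forall>k. Ck_on n k V f)"

type_synonym 'a chart = "'a set \<times> ('a \<Rightarrow> nat \<Rightarrow> real)"

definition is_chart :: "nat \<Rightarrow> 'a::topological_space chart \<Rightarrow> bool" where
  "is_chart n c \<longleftrightarrow> (case c of (U, \<phi>) \<Rightarrow>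
     open U \<and> openin (Euclidean_space n) (\<phi> ` U) \<and>
     homeomorphic_map (top_of_set U) (subtopology (Euclidean_space n) (\<phi> ` U)) \<phi>)"

definition smooth_manifold ::
  "nat \<Rightarrow> 'a::{t2_space, second_countable_topology} chart set \<Rightarrow> bool" where
  "smooth_manifold n \<A> \<longleftrightarrow>
     (\<forall>c\<in>\<A>. is_chart n c) \<and> (\<Union>(U, \<phi>)\<in>\<A>. U) = UNIV \<and>
     (\<forall>(U, \<phi>)\<in>\<A>. \<forall>(W, \<psi>)\<in>\<A>. \<forall>i<n.
        smooth_on n (\<phi> ` (U \<inter> W)) (\<lambda>x. \<psi> (inv_into U \<phi> x) i))"

definition smooth_fun ::
  "nat \<Rightarrow> 'a chart set \<Rightarrow> ('a \<Rightarrow> 'b::real_normed_vector) \<Rightarrow> bool" where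
  "smooth_fun n \<A> f \<longleftrightarrow> (\<forall>(U, \<phi>)\<in>\<A>. smooth_on n (\<phi> ` U) (\<lambda>x. f (inv_into U \<phi> x)))"


section \<open>The complexified tangent bundle\<close>

text \<open>
  Tangent vectors are derivations of the algebra of smooth real functions; they are set to \<open>0\<close> on
  non-smooth functions so that equality in HOL is equality of derivations.  An element \<open>u + \<i> w\<close> of
  \<open>\<complex>T\<^sub>p = T\<^sub>p \<otimes> \<complex>\<close>, with \<open>u, w \<in> T\<^sub>p\<close>, is the complex valued functional \<open>f \<mapsto> u f + \<i> w f\<close>.
\<close>

definition tangent_space :: "nat \<Rightarrow> 'a chart set \<Rightarrow> 'a \<Rightarrow> (('a \<Rightarrow> real) \<Rightarrow> real) set" where
  "tangent_space n \<A> p = {v.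
     (\<forall>f g. smooth_fun n \<A> f \<longrightarrow> smooth_fun n \<A> g \<longrightarrow>
        v (\<lambda>x. f x + g x) = v f + v g \<and>
        v (\<lambda>x. f x * g x) = f p * v g + g p * v f) \<and>
     (\<forall>c f. smooth_fun n \<A> f \<longrightarrow> v (\<lambda>x. c * f x) = c * v f) \<and>
     (\<forall>f. \<not> smooth_fun n \<A> f \<longrightarrow> v f = 0)}"

type_synonym 'a cvec = "('a \<Rightarrow> real) \<Rightarrow> complex"
type_synonym 'a vfield = "'a \<Rightarrow> 'a cvec"

definition ctangent_space :: "nat \<Rightarrow> 'a chart set \<Rightarrow> 'a \<Rightarrow> 'a cvec set" where
  "ctangent_space n \<A> p =
     {v. (\<lambda>f. Re (v f)) \<in> tangent_space n \<A> p \<and> (\<lambda>f. Im (v f)) \<in> tangent_space n \<A> p}"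

definition vfields :: "nat \<Rightarrow> 'a chart set \<Rightarrow> 'a vfield set" where
  "vfields n \<A> = {X. (\<forall>p. X p \<in> ctangent_space n \<A> p) \<and>
     (\<forall>f :: 'a \<Rightarrow> real. smooth_fun n \<A> f \<longrightarrow> smooth_fun n \<A> (\<lambda>p. X p f))}"

definition vscale :: "complex \<Rightarrow> 'a cvec \<Rightarrow> 'a cvec" where
  "vscale c v = (\<lambda>f. c * v f)"

definition fscale :: "('a \<Rightarrow> complex) \<Rightarrow> 'a vfield \<Rightarrow> 'a vfield" where
  "fscale f X = (\<lambda>p. vscale (f p) (X p))"

text \<open>Complex linear extension of a complex tangent vector to complex valued functions.\<close>

definition cact :: "'a cvec \<Rightarrow> ('a \<Rightarrow> complex) \<Rightarrow> complex" where
  "cact v f = v (\<lambda>x. Re (f x)) + \<i> * v (\<lambda>x. Im (f x))"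

definition lie_bracket :: "'a vfield \<Rightarrow> 'a vfield \<Rightarrow> 'a vfield" where
  "lie_bracket X Y = (\<lambda>p f. cact (X p) (\<lambda>q. Y q f) - cact (Y p) (\<lambda>q. X q f))"


section \<open>Covariant derivatives and tensors\<close>

text \<open>
  \<open>D X Y\<close> is \<open>\<nabla>\<^sub>X Y\<close>.  As for all tensors with values in \<open>\<complex>T\<^sub>M\<close>, the direction entry \<open>X\<close> is
  extended complex linearly, so that \<open>X\<close> is allowed to be a section of \<open>\<complex>T\<^sub>M\<close>.
\<close>

definition complex_covariant_derivative ::
  "nat \<Rightarrow> 'a chart set \<Rightarrow> ('a vfield \<Rightarrow> 'a vfield \<Rightarrow> 'a vfield) \<Rightarrow> bool" where
  "complex_covariant_derivative n \<A> D \<longleftrightarrow>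
     (\<forall>X\<in>vfields n \<A>. \<forall>Y\<in>vfields n \<A>. D X Y \<in> vfields n \<A> \<and>
        (\<forall>Z\<in>vfields n \<A>. D (X + Z) Y = D X Y + D Z Y \<and> D X (Y + Z) = D X Y + D X Z) \<and>
        (\<forall>f :: 'a \<Rightarrow> complex. smooth_fun n \<A> f \<longrightarrow>
           D (fscale f X) Y = fscale f (D X Y) \<and>
           D X (fscale f Y) = fscale (\<lambda>p. cact (X p) f) Y + fscale f (D X Y)))"

definition torsion_free ::
  "nat \<Rightarrow> 'a chart set \<Rightarrow> ('a vfield \<Rightarrow> 'a vfield \<Rightarrow> 'a vfield) \<Rightarrow> bool" where
  "torsion_free n \<A> D \<longleftrightarrow>
     (\<forall>X\<in>vfields n \<A>. \<forall>Y\<in>vfields n \<A>. D X Y - D Y X = lie_bracket X Y)"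

text \<open>
  A smooth section of \<open>T\<^sub>M\<^sup>*\<^sup>,\<^sup>\<otimes>\<^sup>m \<otimes> \<complex>T\<^sub>M\<close>, extended complex multilinearly: \<open>T p\<close> is a complex
  multilinear map on lists of \<open>m\<close> elements of \<open>\<complex>T\<^sub>p\<close>, and smooth fields are sent to smooth fields.
\<close>

definition on_fields :: "('a \<Rightarrow> 'a cvec list \<Rightarrow> 'a cvec) \<Rightarrow> 'a vfield list \<Rightarrow> 'a vfield" where
  "on_fields T Xs = (\<lambda>p. T p (map (\<lambda>X. X p) Xs))"

definition smooth_tensor ::
  "nat \<Rightarrow> 'a chart set \<Rightarrow> nat \<Rightarrow> ('a \<Rightarrow> 'a cvec list \<Rightarrow> 'a cvec) \<Rightarrow> bool" where
  "smooth_tensor n \<A> m T \<longleftrightarrow>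
     (\<forall>p. \<forall>vs\<in>lists (ctangent_space n \<A> p). length vs = m \<longrightarrow> T p vs \<in> ctangent_space n \<A> p) \<and>
     (\<forall>p. \<forall>us\<in>lists (ctangent_space n \<A> p). \<forall>ws\<in>lists (ctangent_space n \<A> p).
        \<forall>v\<in>ctangent_space n \<A> p. \<forall>v'\<in>ctangent_space n \<A> p. \<forall>c.
        length us + 1 + length ws = m \<longrightarrow>
        T p (us @ (vscale c v + v') # ws) = vscale c (T p (us @ v # ws)) + T p (us @ v' # ws)) \<and>
     (\<forall>Xs\<in>lists (vfields n \<A>). length Xs = m \<longrightarrow> on_fields T Xs \<in> vfields n \<A>)"

text \<open>Smooth sections of \<open>T\<^sub>M\<^sup>* \<otimes> S\<^sup>k T\<^sub>M\<^sup>* \<otimes> \<complex>T\<^sub>M\<close>.\<close>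

definition smooth_sym_tensor ::
  "nat \<Rightarrow> 'a chart set \<Rightarrow> nat \<Rightarrow> ('a \<Rightarrow> 'a cvec list \<Rightarrow> 'a cvec) \<Rightarrow> bool" where
  "smooth_sym_tensor n \<A> k T \<longleftrightarrow> smooth_tensor n \<A> (k + 1) T \<and>
     (\<forall>p. \<forall>v\<in>ctangent_space n \<A> p.
        \<forall>us\<in>lists (ctangent_space n \<A> p). \<forall>ws\<in>lists (ctangent_space n \<A> p).
        length us = k \<longrightarrow> mset us = mset ws \<longrightarrow> T p (v # us) = T p (v # ws))"

text \<open>
  Tensor calculus is done on smooth vector fields: a tensor with \<open>m\<close> entries acts on lists of \<open>m\<close>
  vector fields and is determined by this action, since every tangent vector is a value of a
  global smooth vector field.
\<close>

type_synonym 'a tensor_op = "'a vfield list \<Rightarrow> 'a vfield"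

definition tensor_eq :: "nat \<Rightarrow> 'a chart set \<Rightarrow> nat \<Rightarrow> 'a tensor_op \<Rightarrow> 'a tensor_op \<Rightarrow> bool" where
  "tensor_eq n \<A> m A B \<longleftrightarrow> (\<forall>Xs\<in>lists (vfields n \<A>). length Xs = m \<longrightarrow> A Xs = B Xs)"

definition tscale :: "complex \<Rightarrow> 'a tensor_op \<Rightarrow> 'a tensor_op" where
  "tscale c A = (\<lambda>Xs. fscale (\<lambda>_. c) (A Xs))"

fun nabla :: "('a vfield \<Rightarrow> 'a vfield \<Rightarrow> 'a vfield) \<Rightarrow> 'a tensor_op \<Rightarrow> 'a tensor_op" where
  "nabla D A (X # Ys) = D X (A Ys) - (\<Sum>i<length Ys. A (Ys[i := D X (Ys ! i)]))"

fun curvature :: "('a vfield \<Rightarrow> 'a vfield \<Rightarrow> 'a vfield) \<Rightarrow> 'a tensor_op" where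
  "curvature D [X, Y, Z] = D X (D Y Z) - D Y (D X Z) - D (lie_bracket X Y) Z"

definition nabla_curv :: "('a vfield \<Rightarrow> 'a vfield \<Rightarrow> 'a vfield) \<Rightarrow> nat \<Rightarrow> 'a tensor_op" where
  "nabla_curv D a = (nabla D ^^ a) (curvature D)"

fun swap12 :: "'a tensor_op \<Rightarrow> 'a tensor_op" where
  "swap12 A (X # Y # Zs) = A (Y # X # Zs)"

fun d1 :: "('a vfield \<Rightarrow> 'a vfield \<Rightarrow> 'a vfield) \<Rightarrow> 'a tensor_op \<Rightarrow> 'a tensor_op" where
  "d1 D A (X # Y # Zs) = nabla D A (X # Y # Zs) - nabla D A (Y # X # Zs)"

definition id1 :: "('a vfield \<Rightarrow> 'a vfield \<Rightarrow> 'a vfield) \<Rightarrow> 'a tensor_op \<Rightarrow> 'a tensor_op" where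
  "id1 D A = tscale \<i> (d1 D A)"

text \<open>\<open>wedge1 l A B\<close> is \<open>A \<and>\<^sub>1 B\<close> for a tensor \<open>B\<close> with \<open>l + 1\<close> entries.\<close>

fun wedge1 :: "nat \<Rightarrow> 'a tensor_op \<Rightarrow> 'a tensor_op \<Rightarrow> 'a tensor_op" where
  "wedge1 l A B (X # Y # Zs) =
     A (X # B (Y # take l Zs) # drop l Zs) - A (Y # B (X # take l Zs) # drop l Zs)"

text \<open>Entries are numbered from \<open>1\<close>; \<open>Sym I\<close> sums over all permutations of the entries in \<open>I\<close>.\<close>

definition entry :: "'b list \<Rightarrow> nat \<Rightarrow> 'b" where
  "entry Xs r = Xs ! (r - 1)"

definition Sym :: "nat set \<Rightarrow> 'a tensor_op \<Rightarrow> 'a tensor_op" where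
  "Sym I A Xs = (\<Sum>\<sigma> | \<sigma> permutes I. A (map (\<lambda>r. entry Xs (\<sigma> r)) [1..<length Xs + 1]))"

definition Theta ::
  "('a vfield \<Rightarrow> 'a vfield \<Rightarrow> 'a vfield) \<Rightarrow> (nat \<Rightarrow> 'a \<Rightarrow> 'a cvec list \<Rightarrow> 'a cvec) \<Rightarrow> nat \<Rightarrow> 'a tensor_op"
where
  "Theta D S k =
     (if k = 2 then tscale 2 (curvature D)
      else tscale (- 2 * \<i>) ((id1 D ^^ (k - 3)) (swap12 (nabla D (curvature D)))) +
        (\<Sum>r = 3..k-1. tscale (fact (r + 1)) (\<Sum>p = 2..r-1.
           (id1 D ^^ (k - 1 - r))
             (wedge1 (r - p + 1) (tscale (of_nat p) (on_fields (S p))) (on_fields (S (r - p + 1)))))))"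


section \<open>Multi-indices\<close>

text \<open>
  \<open>mnorm A\<close> is \<open>\<parallel>A\<parallel>\<close> and \<open>mnorm_upto A j\<close> is \<open>\<parallel>A\<parallel>\<^sub>j\<close>.  Note that \<open>mnorm A\<close> differs
  from \<open>mnorm_upto A (length A)\<close>.
\<close>

definition mnorm_upto :: "nat list \<Rightarrow> nat \<Rightarrow> nat" where
  "mnorm_upto A j = sum_list (take j A) + j"

definition mnorm :: "nat list \<Rightarrow> nat" where
  "mnorm A = mnorm_upto A (length A) + length A"

definition mfact :: "nat list \<Rightarrow> complex" where
  "mfact A = (\<Prod>a\<leftarrow>A. fact a)"

text \<open>The fold is the composition of the factors for \<open>j = 1, \<dots>, l\<^sub>A\<close>, applied to the first entry.\<close>

definition R_multi :: "('a vfield \<Rightarrow> 'a vfield \<Rightarrow> 'a vfield) \<Rightarrow> nat list \<Rightarrow> 'a tensor_op" where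
  "R_multi D A Xs =
     foldr (\<lambda>j V. nabla_curv D (A ! (j - 1))
              (map (entry Xs) [mnorm_upto A (j - 1) + 2..<mnorm_upto A j + 2] @
               [V, entry Xs (mnorm A - j + 2)]))
       [1..<length A + 1] (entry Xs 1)"

definition compositions :: "nat \<Rightarrow> nat list set" where
  "compositions l = {\<mu>. \<mu> \<noteq> [] \<and> (\<forall>x\<in>set \<mu>. x \<ge> 1) \<and> sum_list \<mu> = l}"

text \<open>\<open>seg H s h\<close> is the segment \<open>H'\<^sub>s\<^sub>,\<^sub>h = (H\<^sub>s\<^sub>+\<^sub>1, \<dots>, H\<^sub>h)\<close>.\<close>

definition seg :: "nat list \<Rightarrow> nat \<Rightarrow> nat \<Rightarrow> nat list" where
  "seg H s h = drop s (take h H)"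

definition coeff_C :: "nat list \<Rightarrow> complex" where
  "coeff_C H = (\<Sum>\<mu>\<in>compositions (length H).
     (- 1) ^ length \<mu> * of_nat (mnorm (take (hd \<mu>) H)) *
     (\<Prod>j = 1..length \<mu>. \<Prod>s = sum_list (take (j - 1) \<mu>)..<sum_list (take j \<mu>).
        1 / of_nat (mnorm (seg H s (sum_list (take j \<mu>))) *
                    (mnorm (seg H s (sum_list (take j \<mu>))) + 1))))"

definition coeff_CA :: "nat list \<Rightarrow> complex" where
  "coeff_CA A = - ((- \<i>) ^ mnorm A) * fact (mnorm A + 1) *
     (\<Sum>H | list_all2 (\<le>) H A.
        (- 1) ^ sum_list H * coeff_C H / (mfact H * mfact (map2 (-) A H)))"

end

(*
  The curvature tensors R^E and the tensors Theta_k are only needed through their values on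
  (x, y, ..., y): Sym over the remaining entries is recovered by polarization.  All tensors in
  question vanish on (y, ..., y), so on (x, y, ..., y) the operator d_1 acts as minus the derivative
  A |-> (nabla_y A)(x, y, ..., y), which sends R^E to the sum of the R^F, F running over the
  multi-indices obtained by raising one entry of E by one; and p S_p wedge_1 S_q becomes the
  composition S_p(S_q(x, y, ..., y), y, ..., y), with R^E composed with R^F equal to R^(E F).
  Hence the recursion for S_k becomes the recursion
    C_A = -i sum_j C_(A - e_j) + ||A||! sum_(A = E F) c_E c_F,  c_E = i C_E / (||E|| + 1)!,
  for the coefficients.  Up to elementary factors C_A is a binomial transform of C(H), which
  commutes with concatenation and turns the recursion into (||H|| + 1) C = C * C - P, where * is
  the convolution over splittings of lists and P is the indicator of lists of length one.
*)
theory Submission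
  imports Defs
begin

section \<open>The coefficients\<close>

text \<open>A coefficient function is a noncommutative formal power series in the letters 0, 1, 2,
  ...; \<open>conv\<close> is the product of such series and weighting by \<open>mnorm\<close> is a
  derivation n. The alternating sum over compositions in C(H) is the geometric expansion of -(n U)
  times the inverse of U, for a series U with constant term 1: C is minus a logarithmic derivative.
  This is the classical substitution that linearizes a Riccati equation, and it is why a quadratic
  recursion has a closed solution. On the tensor side the obstacle is that (nabla_y A)(x, y, ..., y)
  involves A with D_y y in one slot, which the values on (x, y, ..., y) do not show. Only the sum
  over all slots occurs, and it is the derivative of y \<mapsto> A(x, y, ..., y) in the direction
  D_y y, so these values suffice even for A without symmetry. The R^E may be linearly dependent, so
  coefficients are never compared. The recursion only serves to show that, once the lower S_j have
  the closed form, both right hand sides for S_k agree.\<close>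

fun conv :: "(nat list \<Rightarrow> complex) \<Rightarrow> (nat list \<Rightarrow> complex) \<Rightarrow> nat list \<Rightarrow> complex" where
  "conv f g [] = f [] * g []"
| "conv f g (a # A) = f [] * g (a # A) + conv (\<lambda>K. f (a # K)) g A"

definition grade :: "(nat list \<Rightarrow> complex) \<Rightarrow> nat list \<Rightarrow> complex" where
  "grade f A = of_nat (mnorm A) * f A"

lemma mnorm_Nil [simp]: "mnorm [] = 0"
  by (simp add: mnorm_def mnorm_upto_def)

lemma mnorm_Cons [simp]: "mnorm (a # A) = a + 2 + mnorm A"
  by (simp add: mnorm_def mnorm_upto_def)

lemma mnorm_append: "mnorm (A @ B) = mnorm A + mnorm B"
  by (induction A) auto

lemma mnorm_eq_0_iff [simp]: "mnorm A = 0 \<longleftrightarrow> A = []"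
  by (cases A) auto

lemma conv_eq_sum: "conv f g A = (\<Sum>t\<le>length A. f (take t A) * g (drop t A))"
proof (induction A arbitrary: f)
  case (Cons a A)
  show ?case
    by (simp add: Cons sum.atMost_Suc_shift del: sum.atMost_Suc)
qed simp

lemma conv_add_left: "conv (\<lambda>K. f K + f' K) g A = conv f g A + conv f' g A"
  by (induction A arbitrary: f f') (auto simp: algebra_simps)

lemma conv_diff_left: "conv (\<lambda>K. f K - f' K) g A = conv f g A - conv f' g A"
  by (induction A arbitrary: f f') (auto simp: algebra_simps)

lemma conv_scale_left: "conv (\<lambda>K. c * f K) g A = c * conv f g A"
  by (induction A arbitrary: f) (auto simp: algebra_simps)

lemma conv_scale_right: "conv f (\<lambda>K. c * g K) A = c * conv f g A"
  by (induction A arbitrary: f) (auto simp: algebra_simps)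

lemma conv_minus_right: "conv f (\<lambda>K. - g K) A = - conv f g A"
  using conv_scale_right[of f "-1" g A] by simp

lemma conv_assoc: "conv (conv f g) h A = conv f (conv g h) A"
proof (induction A arbitrary: f g)
  case (Cons a A)
  have eq: "(\<lambda>K. conv f g (a # K)) = (\<lambda>K. f [] * g (a # K) + conv (\<lambda>L. f (a # L)) g K)"
    by simp
  show ?case
    by (simp add: eq conv_add_left conv_scale_left Cons algebra_simps)
qed simp

text \<open>\<open>mnorm\<close> is additive under concatenation, so weighting by it obeys the
  Leibniz rule.\<close>

lemma grade_conv: "grade (conv f g) A = conv (grade f) g A + conv f (grade g) A"
proof (induction A arbitrary: f)
  case (Cons a A)
  have eq: "(\<lambda>K. grade f (a # K)) = (\<lambda>K. of_nat (a + 2) * f (a # K) + grade (\<lambda>L. f (a # L)) K)"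
    by (auto simp: grade_def algebra_simps)
  have "conv (\<lambda>K. grade f (a # K)) g A =
      of_nat (a + 2) * conv (\<lambda>K. f (a # K)) g A + conv (grade (\<lambda>L. f (a # L))) g A"
    unfolding eq by (simp only: conv_add_left conv_scale_left)
  moreover have "grade (conv (\<lambda>K. f (a # K)) g) A =
      conv (grade (\<lambda>K. f (a # K))) g A + conv (\<lambda>K. f (a # K)) (grade g) A"
    by (rule Cons)
  moreover have "conv (\<lambda>K. f (a # K)) (grade g) A = conv (\<lambda>K. f (a # K)) (\<lambda>K. of_nat (mnorm K) * g K) A"
    unfolding grade_def ..
  ultimately show ?case
    by (simp add: grade_def algebra_simps)
qed (simp add: grade_def)

text \<open>A series with nonzero constant term can be cancelled: by induction on the length every
  proper prefix of \<open>A\<close> contributes 0, and the term left is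
  \<open>f A * g []\<close>.\<close>

lemma conv_right_cancel:
  assumes "\<And>A. conv f g A = 0" "g [] \<noteq> 0"
  shows "f A = 0"
proof (induction A rule: length_induct)
  case (1 A)
  have "0 = (\<Sum>t\<le>length A. f (take t A) * g (drop t A))"
    using assms(1) by (simp add: conv_eq_sum)
  also have "\<dots> = (\<Sum>t\<in>{length A}. f (take t A) * g (drop t A))"
    by (rule sum.mono_neutral_right) (use 1 in auto)
  finally show ?case using assms(2) by simp
qed

section \<open>The closed formula for C(H)\<close>

fun block_weight :: "nat list \<Rightarrow> complex" where
  "block_weight [] = 1"
| "block_weight (k # K) = block_weight K / of_nat (mnorm (k # K) * (mnorm (k # K) + 1))"

definition single :: "nat list \<Rightarrow> complex" where
  "single A = (if length A = 1 then 1 else 0)"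

lemma conv_single: "conv single f A = (case A of [] \<Rightarrow> 0 | a # B \<Rightarrow> f B)"
proof (cases A)
  case (Cons a B)
  have "conv (\<lambda>K. single (a # K)) f B = f B"
  proof -
    have "conv (\<lambda>K. single (a # K)) f B = (\<Sum>t\<le>length B. single (a # take t B) * f (drop t B))"
      by (rule conv_eq_sum)
    also have "\<dots> = (\<Sum>t\<in>{0}. single (a # take t B) * f (drop t B))"
      by (rule sum.mono_neutral_right) (auto simp: single_def)
    finally show ?thesis by (simp add: single_def)
  qed
  then show ?thesis by (simp add: Cons single_def)
qed (simp add: single_def)

text \<open>Left multiplication by \<open>single\<close> drops the first entry, so this is the
  recursion defining \<open>block_weight\<close> with denominators cleared. It is the second order
  linear equation behind the Riccati equation.\<close>

lemma block_weight_grade: "grade (grade block_weight) A + grade block_weight A = conv single block_weight A"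
proof (cases A)
  case (Cons a B)
  let ?n = "of_nat (mnorm A) :: complex"
  have n: "?n \<noteq> 0"
    unfolding of_nat_eq_0_iff by (simp add: Cons)
  have n1: "?n + 1 \<noteq> 0"
    using of_nat_neq_0[of "mnorm A", where 'a = complex] by (simp only: of_nat_Suc add.commute not_False_eq_True)
  have "block_weight A = block_weight B / (?n * (?n + 1))"
    unfolding Cons by (simp add: algebra_simps)
  then have "?n * (?n + 1) * block_weight A = block_weight B"
    using n n1 by simp
  then have "?n * (?n * block_weight A) + ?n * block_weight A = block_weight B"
    by (simp add: algebra_simps)
  then show ?thesis
    unfolding conv_single Cons by (simp add: grade_def Cons)
qed (simp add: grade_def conv_single single_def)

text \<open>In C(H) the inner product over one block of a composition runs over the nonempty
  suffixes of that block; \<open>block_weight\<close> is this product as a function of the block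
  alone.\<close>

lemma block_weight_eq_prod:
  "block_weight K = (\<Prod>s=0..<length K. 1 / of_nat (mnorm (drop s K) * (mnorm (drop s K) + 1)))"
proof (induction K)
  case (Cons a K)
  then show ?case
    by (simp add: prod.atLeast0_lessThan_Suc_shift del: prod.op_ivl_Suc mnorm_Cons)
qed simp

lemma finite_compositions: "finite (compositions l)"
proof -
  have "length \<mu> \<le> sum_list \<mu>" if "\<forall>x\<in>set \<mu>. x \<ge> 1" for \<mu> :: "nat list"
    using that by (induction \<mu>) auto
  then have "compositions l \<subseteq> {\<mu>. set \<mu> \<subseteq> {..l} \<and> length \<mu> \<le> l}"
    using member_le_sum_list by (fastforce simp: compositions_def)
  then show ?thesis
    using finite_lists_length_le[of "{..l}" l] finite_subset by blast
qed

definition composition_term :: "nat list \<Rightarrow> nat list \<Rightarrow> complex" where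
  "composition_term H \<mu> = (- 1) ^ length \<mu> * of_nat (mnorm (take (hd \<mu>) H)) *
     (\<Prod>j = 1..length \<mu>. \<Prod>s = sum_list (take (j - 1) \<mu>)..<sum_list (take j \<mu>).
        1 / of_nat (mnorm (seg H s (sum_list (take j \<mu>))) *
                    (mnorm (seg H s (sum_list (take j \<mu>))) + 1)))"

lemma sum_list_take_le: "sum_list (take j \<mu>) \<le> sum_list (\<mu>::nat list)"
  by (metis append_take_drop_id le_add1 sum_list_append)

lemma last_block_prod:
  assumes "t \<le> length H"
  shows "(\<Prod>s=t..<length H. 1 / of_nat (mnorm (drop s H) * (mnorm (drop s H) + 1))) = block_weight (drop t H)"
proof -
  have "(\<Prod>s=t..<length H. 1 / complex_of_nat (mnorm (drop s H) * (mnorm (drop s H) + 1))) =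
    (\<Prod>s=0+t..<(length H - t) + t. 1 / of_nat (mnorm (drop s H) * (mnorm (drop s H) + 1)))"
    using assms by simp
  also have "\<dots> = (\<Prod>s=0..<length H - t. 1 / of_nat (mnorm (drop (s + t) H) * (mnorm (drop (s + t) H) + 1)))"
    by (rule prod.shift_bounds_nat_ivl)
  finally show ?thesis
    unfolding block_weight_eq_prod by simp
qed

lemma composition_term_singleton:
  "H \<noteq> [] \<Longrightarrow> composition_term H [length H] = - of_nat (mnorm H) * block_weight H"
  using last_block_prod[of 0 H] by (simp add: composition_term_def seg_def)

text \<open>The last block is split off rather than the first, since the first carries the extra
  factor \<open>mnorm (take (hd \<mu>) H)\<close>; the last one contributes only a sign and its
  \<open>block_weight\<close>.\<close>

lemma composition_term_snoc:
  assumes "\<mu> \<noteq> []" "sum_list \<mu> = t" "t \<le> length H"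
  shows "composition_term H (\<mu> @ [length H - t]) = - composition_term (take t H) \<mu> * block_weight (drop t H)"
proof -
  let ?m = "length H - t"
  let ?f = "\<lambda>H \<mu> j. \<Prod>s = sum_list (take (j - 1) \<mu>)..<sum_list (take j \<mu>).
        1 / complex_of_nat (mnorm (seg H s (sum_list (take j \<mu>))) *
                    (mnorm (seg H s (sum_list (take j \<mu>))) + 1))"
  \<comment> \<open>The first block lies inside \<open>take t H\<close>, so the extra factor is the
    same for both compositions.\<close>
  have "hd \<mu> \<le> t"
    using assms by (cases \<mu>) auto
  then have hd: "take (hd (\<mu> @ [?m])) H = take (hd \<mu>) (take t H)"
    using assms by simp
  have "(\<Prod>j=1..length (\<mu> @ [?m]). ?f H (\<mu> @ [?m]) j) =
      (\<Prod>j=1..length \<mu>. ?f H (\<mu> @ [?m]) j) * ?f H (\<mu> @ [?m]) (Suc (length \<mu>))"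
    by simp
  also have "(\<Prod>j=1..length \<mu>. ?f H (\<mu> @ [?m]) j) = (\<Prod>j=1..length \<mu>. ?f (take t H) \<mu> j)"
  proof (rule prod.cong[OF refl])
    fix j assume j: "j \<in> {1..length \<mu>}"
    have "sum_list (take j \<mu>) \<le> t"
      using sum_list_take_le[of j \<mu>] assms by simp
    then show "?f H (\<mu> @ [?m]) j = ?f (take t H) \<mu> j"
      using j by (simp add: seg_def)
  qed
  also have "?f H (\<mu> @ [?m]) (Suc (length \<mu>)) = block_weight (drop t H)"
    using last_block_prod[OF assms(3)] assms by (simp add: seg_def)
  finally show ?thesis
    unfolding composition_term_def hd by simp
qed

text \<open>Compositions are nonempty lists of positive parts, so 0 has none. As a consequence the
  two trivial splittings of a list contribute nothing to
  \<open>conv coeff_C coeff_C\<close>.\<close>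

lemma coeff_C_Nil: "coeff_C [] = 0"
proof -
  have "compositions 0 = {}"
    unfolding compositions_def by auto (metis hd_in_set not_one_le_zero One_nat_def)
  then show ?thesis by (simp add: coeff_C_def)
qed

lemma compositions_split:
  assumes "l \<ge> 1"
  shows "compositions l = insert [l] ((\<lambda>(t, \<mu>). \<mu> @ [l - t]) ` (SIGMA t:{1..<l}. compositions t))"
    (is "_ = ?R")
proof (intro equalityI subsetI)
  fix \<mu> assume mu: "\<mu> \<in> compositions l"
  then obtain \<mu>' m where eq: "\<mu> = \<mu>' @ [m]"
    by (metis (mono_tags, lifting) append_butlast_last_id compositions_def mem_Collect_eq)
  show "\<mu> \<in> ?R"
  proof (cases "\<mu>' = []")
    case False
    then obtain x xs where "\<mu>' = x # xs" by (cases \<mu>') auto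
    with mu eq False have "sum_list \<mu>' \<in> {1..<l}" "\<mu>' \<in> compositions (sum_list \<mu>')" "m = l - sum_list \<mu>'"
      by (auto simp: compositions_def)
    with eq show ?thesis by force
  qed (use mu eq in \<open>auto simp: compositions_def\<close>)
qed (use assms in \<open>auto simp: compositions_def\<close>)

lemma coeff_C_split:
  assumes "H \<noteq> []"
  shows "coeff_C H = - of_nat (mnorm H) * block_weight H -
    (\<Sum>t=1..<length H. coeff_C (take t H) * block_weight (drop t H))"
proof -
  let ?l = "length H" and ?g = "\<lambda>(t, \<mu>). \<mu> @ [length H - t]"
  have l: "?l \<ge> 1" using assms by (simp add: Suc_leI)
  have "coeff_C H = sum (composition_term H) (compositions ?l)"
    by (simp add: coeff_C_def composition_term_def)
  also have "\<dots> = composition_term H [?l] + sum (composition_term H) (?g ` (SIGMA t:{1..<?l}. compositions t))"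
    unfolding compositions_split[OF l]
  proof (rule sum.insert)
    show "finite (?g ` (SIGMA t:{1..<?l}. compositions t))"
      by (intro finite_imageI finite_SigmaI finite_compositions) simp
    show "[?l] \<notin> ?g ` (SIGMA t:{1..<?l}. compositions t)"
      by (auto simp: compositions_def)
  qed
  also have "sum (composition_term H) (?g ` (SIGMA t:{1..<?l}. compositions t)) =
      (\<Sum>x\<in>(SIGMA t:{1..<?l}. compositions t). composition_term H (?g x))"
    by (subst sum.reindex) (auto simp: inj_on_def compositions_def)
  also have "\<dots> = (\<Sum>t=1..<?l. \<Sum>\<mu>\<in>compositions t. composition_term H (\<mu> @ [?l - t]))"
    by (subst sum.Sigma) (auto simp: finite_compositions case_prod_unfold)
  also have "\<dots> = (\<Sum>t=1..<?l. \<Sum>\<mu>\<in>compositions t. - composition_term (take t H) \<mu> * block_weight (drop t H))"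
    by (intro sum.cong refl composition_term_snoc) (auto simp: compositions_def)
  also have "\<dots> = (\<Sum>t=1..<?l. - (coeff_C (take t H) * block_weight (drop t H)))"
  proof (rule sum.cong[OF refl])
    fix t assume "t \<in> {1..<?l}"
    then have "length (take t H) = t" by simp
    then show "(\<Sum>\<mu>\<in>compositions t. - composition_term (take t H) \<mu> * block_weight (drop t H)) =
        - (coeff_C (take t H) * block_weight (drop t H))"
      unfolding coeff_C_def composition_term_def[symmetric] by (simp add: sum_distrib_right sum_negf)
  qed
  finally show ?thesis
    using assms by (simp add: composition_term_singleton sum_negf)
qed

text \<open>The splitting at \<open>length H\<close> gives C(H) because
  \<open>block_weight [] = 1\<close>, the splitting at 0 vanishes because C is 0 on the empty list,
  and the others form the sum in \<open>coeff_C_split\<close>.\<close>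

lemma conv_coeff_C_block_weight: "conv coeff_C block_weight H = - grade block_weight H"
proof (cases "H = []")
  case False
  then have "{..length H} = insert 0 (insert (length H) {1..<length H})" by auto
  then have "conv coeff_C block_weight H =
      coeff_C H + (\<Sum>t=1..<length H. coeff_C (take t H) * block_weight (drop t H))"
    using False by (simp add: conv_eq_sum coeff_C_Nil)
  then show ?thesis
    using coeff_C_split[OF False] by (simp add: grade_def)
qed (simp add: grade_def coeff_C_Nil)

text \<open>With \<open>n\<close> the grading derivation, \<open>U\<close> the block weights and \<open>P\<close> the indicator of lists of
  length one, \<open>G * U = - n U\<close> and \<open>n (n + 1) U = P * U\<close>.  Applying \<open>n\<close> to the former and
  cancelling \<open>U\<close> gives \<open>(n + 1) G = G * G - P\<close>.\<close>

lemma coeff_C_riccati: "(of_nat (mnorm A) + 1) * coeff_C A = conv coeff_C coeff_C A - single A"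
proof -
  let ?G = "coeff_C" and ?U = "block_weight"
  let ?X = "\<lambda>K. conv ?G ?G K - grade ?G K - ?G K - single K"
  have GU: "conv ?G ?U = (\<lambda>K. - grade ?U K)"
    using conv_coeff_C_block_weight by blast
  have "conv ?X ?U B = 0" for B
  proof -
    have "conv ?X ?U B = conv (conv ?G ?G) ?U B - conv (grade ?G) ?U B - conv ?G ?U B - conv single ?U B"
      by (simp add: conv_diff_left)
    moreover have "conv (conv ?G ?G) ?U B = - conv ?G (grade ?U) B"
      by (simp add: conv_assoc GU conv_minus_right)
    moreover have "grade (conv ?G ?U) B = - grade (grade ?U) B"
      by (simp add: GU grade_def)
    ultimately show ?thesis
      using grade_conv[of ?G ?U B] block_weight_grade[of B] by (simp add: GU) algebra
  qed
  then have "?X A = 0"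
    by (rule conv_right_cancel) simp
  then show ?thesis by (simp add: grade_def algebra_simps)
qed

section \<open>The binomial transform\<close>

text \<open>The weight of \<open>h \<le> a\<close> in the sum over \<open>0 \<le> H \<le> A\<close> defining \<open>C\<^sub>A\<close>, for a single entry.\<close>

definition binomial_weight :: "nat \<Rightarrow> nat \<Rightarrow> complex" where
  "binomial_weight a h = (- 1) ^ h / (fact h * fact (a - h))"

text \<open>The weight of H factors over its entries, so the sum over H \<le> A can be taken one
  entry at a time; in this form compatibility with \<open>conv\<close> is an induction.
  \<open>binomial_transform_eq_sum\<close> recovers the sum in the definition of C_A.\<close>

fun binomial_transform :: "(nat list \<Rightarrow> complex) \<Rightarrow> nat list \<Rightarrow> complex" where
  "binomial_transform f [] = f []"
| "binomial_transform f (a # A) = (\<Sum>h\<le>a. binomial_weight a h * binomial_transform (\<lambda>K. f (h # K)) A)"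

text \<open>The transpose of raising one entry of a multi-index by one: this is what a covariant
  derivative does to the coefficients of a combination of the R^E.\<close>

fun del :: "(nat list \<Rightarrow> complex) \<Rightarrow> nat list \<Rightarrow> complex" where
  "del f [] = 0"
| "del f (a # A) = (if a = 0 then 0 else f ((a - 1) # A)) + del (\<lambda>K. f (a # K)) A"

lemma binomial_transform_add: "binomial_transform (\<lambda>K. f K + g K) A = binomial_transform f A + binomial_transform g A"
  by (induction A arbitrary: f g) (auto simp: algebra_simps sum.distrib)

lemma binomial_transform_scale: "binomial_transform (\<lambda>K. c * f K) A = c * binomial_transform f A"
  by (induction A arbitrary: f) (auto simp: algebra_simps sum_distrib_left)

lemma binomial_transform_diff: "binomial_transform (\<lambda>K. f K - g K) A = binomial_transform f A - binomial_transform g A"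
  using binomial_transform_add[of f "\<lambda>K. - 1 * g K" A] unfolding binomial_transform_scale by simp

lemma del_add: "del (\<lambda>K. f K + g K) A = del f A + del g A"
  by (induction A arbitrary: f g) (auto simp: algebra_simps)

lemma del_scale: "del (\<lambda>K. c * f K) A = c * del f A"
  by (induction A arbitrary: f) (auto simp: algebra_simps)

lemma del_sum: "del (\<lambda>K. \<Sum>i\<in>I. f i K) A = (\<Sum>i\<in>I. del (f i) A)"
proof (induction I rule: infinite_finite_induct)
  case (insert x F)
  then show ?case by (simp add: del_add)
qed (use del_scale[of 0 "\<lambda>_. 0"] in auto)

lemma binomial_transform_conv: "binomial_transform (conv f g) A = conv (binomial_transform f) (binomial_transform g) A"
proof (induction A arbitrary: f)
  case (Cons a A)
  have shift: "binomial_transform f (a # A') = (\<Sum>h\<le>a. binomial_weight a h * binomial_transform (\<lambda>K. f (h # K)) A')" for A' f by simp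
  have conv_sum: "conv (\<lambda>K. \<Sum>h\<in>I. F h K) G B = (\<Sum>h\<in>I. conv (F h) G B)" if "finite I" for F G B and I :: "nat set"
    using that by (induction I) (auto simp: conv_add_left intro: conv_scale_left[of 0 "\<lambda>_. 0", simplified])
  have "binomial_transform (conv f g) (a # A) = (\<Sum>h\<le>a. binomial_weight a h *
      (f [] * binomial_transform (\<lambda>K. g (h # K)) A + conv (binomial_transform (\<lambda>K. f (h # K))) (binomial_transform g) A))"
    by (simp add: binomial_transform_add binomial_transform_scale Cons)
  also have "\<dots> = f [] * binomial_transform g (a # A) + conv (\<lambda>K. binomial_transform f (a # K)) (binomial_transform g) A"
    by (simp add: conv_sum conv_scale_left algebra_simps sum.distrib sum_distrib_left)
  finally show ?case by simp
qed simp

lemma binomial_weight_sum: "(\<Sum>h\<le>a. binomial_weight a h) = (if a = 0 then 1 else 0)"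
proof -
  have "binomial_weight a h * fact a = (- 1) ^ h * of_nat (a choose h)" if "h \<le> a" for h
    using that by (simp add: binomial_weight_def binomial_fact)
  then have "(\<Sum>h\<le>a. binomial_weight a h) * fact a = (\<Sum>h\<le>a. (- 1) ^ h * of_nat (a choose h))"
    by (simp add: sum_distrib_right)
  also have "\<dots> = (if a = 0 then 1 else 0)"
    by (cases "a = 0") (simp_all add: choose_alternating_sum)
  finally show ?thesis by (auto split: if_splits)
qed

text \<open>Only lists of length one contribute, and their total weight is (1 - 1)^a / a!. So the
  inhomogeneous term of the Riccati equation survives only at [0], that is, for the curvature
  itself.\<close>

lemma binomial_transform_single: "binomial_transform single A = (if A = [0] then 1 else 0)"
proof (cases A)
  case (Cons a B)
  have zero: "binomial_transform (\<lambda>K. 0) B = 0" for B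
    using binomial_transform_scale[of 0 "\<lambda>_. 0"] by simp
  show ?thesis
  proof (cases B)
    case Nil
    then show ?thesis using Cons binomial_weight_sum[of a] by (simp add: single_def)
  next
    case (Cons b B')
    then show ?thesis using \<open>A = a # B\<close> zero by (simp add: single_def)
  qed
qed (simp add: single_def)

text \<open>Each entry splits as a = h + (a - h). The parts h, with the 2 that each entry adds to
  the norm, form the grading of H; and (a - h) times the weight of h in a is, for h < a, the weight
  of h in a - 1, which yields \<open>del\<close>.\<close>

lemma binomial_transform_grade: "of_nat (mnorm A) * binomial_transform f A = binomial_transform (grade f) A + del (binomial_transform f) A"
proof (induction A arbitrary: f)
  case (Cons a A)
  let ?g = "\<lambda>h. binomial_transform (\<lambda>K. f (h # K)) A"
  have "(\<lambda>K. grade f (h # K)) = (\<lambda>K. of_nat (h + 2) * f (h # K) + grade (\<lambda>L. f (h # L)) K)" for h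
    by (auto simp: grade_def algebra_simps)
  then have 1: "binomial_transform (grade f) (a # A) = (\<Sum>h\<le>a. binomial_weight a h *
      (of_nat (h + 2) * ?g h + binomial_transform (grade (\<lambda>L. f (h # L))) A))"
    by (simp add: binomial_transform_add binomial_transform_scale del: of_nat_add)
  have 2: "del (\<lambda>K. binomial_transform f (a # K)) A = (\<Sum>h\<le>a. binomial_weight a h * del (binomial_transform (\<lambda>K. f (h # K))) A)"
    by (simp add: del_sum del_scale)
  have 3: "(if a = 0 then 0 else binomial_transform f ((a - 1) # A)) = (\<Sum>h\<le>a. binomial_weight a h * of_nat (a - h) * ?g h)"
  proof (cases a)
    case (Suc b)
    have "binomial_weight a h * of_nat (a - h) = binomial_weight b h" if "h \<le> b" for h
    proof -
      have "a - h = Suc (b - h)" using that Suc by auto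
      then show ?thesis by (simp add: binomial_weight_def field_simps del: of_nat_Suc)
    qed
    then show ?thesis using Suc by simp
  qed simp
  have "of_nat (mnorm (a # A)) * binomial_transform f (a # A) =
      (\<Sum>h\<le>a. binomial_weight a h * ((of_nat (h + 2) + of_nat (a - h)) * ?g h + of_nat (mnorm A) * ?g h))"
    unfolding binomial_transform.simps sum_distrib_left
    by (rule sum.cong[OF refl]) (auto simp: algebra_simps of_nat_diff)
  then show ?case
    unfolding del.simps 1 2 3 Cons by (simp add: algebra_simps sum.distrib sum_subtractf)
qed (simp add: grade_def)

lemma binomial_transform_coeff_C_riccati:
  "(of_nat (mnorm A) + 1) * binomial_transform coeff_C A =
    del (binomial_transform coeff_C) A + conv (binomial_transform coeff_C) (binomial_transform coeff_C) A - (if A = [0] then 1 else 0)"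
proof -
  have "(\<lambda>K. grade coeff_C K + coeff_C K) = (\<lambda>K. conv coeff_C coeff_C K - single K)"
    using coeff_C_riccati by (auto simp: grade_def algebra_simps fun_eq_iff)
  then have "binomial_transform (grade coeff_C) A + binomial_transform coeff_C A = binomial_transform (conv coeff_C coeff_C) A - binomial_transform single A"
    by (metis binomial_transform_add binomial_transform_diff)
  then show ?thesis
    using binomial_transform_grade[of A coeff_C] by (simp add: binomial_transform_conv binomial_transform_single algebra_simps)
qed

lemma binomial_transform_eq_sum:
  "binomial_transform f A = (\<Sum>H | list_all2 (\<le>) H A. (- 1) ^ sum_list H * f H / (mfact H * mfact (map2 (-) A H)))"
proof (induction A arbitrary: f)
  case (Cons a A)
  let ?t = "\<lambda>A f H. (- 1) ^ sum_list H * f H / (mfact H * mfact (map2 (-) A H))"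
  have "{H. list_all2 (\<le>) H (a # A)} = (\<lambda>(h, K). h # K) ` ({..a} \<times> {K. list_all2 (\<le>) K A})"
    by (auto simp: list_all2_Cons2)
  then have "(\<Sum>H | list_all2 (\<le>) H (a # A). ?t (a # A) f H) =
      (\<Sum>(h, K)\<in>{..a} \<times> {K. list_all2 (\<le>) K A}. ?t (a # A) f (h # K))"
    by (simp add: sum.reindex inj_on_def case_prod_unfold)
  also have "\<dots> = (\<Sum>h\<le>a. \<Sum>K | list_all2 (\<le>) K A. ?t (a # A) f (h # K))"
    by (simp add: sum.cartesian_product)
  also have "\<dots> = (\<Sum>h\<le>a. binomial_weight a h * (\<Sum>K | list_all2 (\<le>) K A. ?t A (\<lambda>L. f (h # L)) K))"
    unfolding sum_distrib_left
    by (intro sum.cong refl) (simp add: binomial_weight_def mfact_def power_add field_simps)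
  finally show ?case by (simp add: Cons)
qed (simp add: mfact_def)

section \<open>The recursion for C_A and its graded form\<close>

lemma coeff_CA_eq: "coeff_CA A = - ((- \<i>) ^ mnorm A) * fact (mnorm A + 1) * binomial_transform coeff_C A"
  by (simp add: coeff_CA_def binomial_transform_eq_sum)

text \<open>The coefficient of R^A in S_k on (x, y, ..., y), with k = \<open>mnorm A\<close>: there
  symmetrization gives k! equal terms, which cancel the k! in the prefactor.\<close>

definition coeff_S :: "nat list \<Rightarrow> complex" where
  "coeff_S A = \<i> * coeff_CA A / fact (mnorm A + 1)"

lemma coeff_S_eq: "coeff_S A = - \<i> * (- \<i>) ^ mnorm A * binomial_transform coeff_C A"
  by (simp add: coeff_S_def coeff_CA_eq del: fact_Suc)

text \<open>Lowering one entry lowers \<open>mnorm\<close> by one, so a factor depending only on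
  \<open>mnorm\<close> passes through \<open>del\<close> with its argument shifted.\<close>

lemma del_grade_scale: "del (\<lambda>K. c (mnorm K) * f K) A = c (mnorm A - 1) * del f A"
proof (induction A arbitrary: c f)
  case (Cons a A)
  have "del (\<lambda>K. c (mnorm (a # K)) * f (a # K)) A = c (mnorm (a # A) - 1) * del (\<lambda>K. f (a # K)) A"
  \<comment> \<open>For the empty list the subtraction in \<open>mnorm A - 1\<close> is truncated,
    but \<open>del\<close> vanishes there; otherwise it is exact.\<close>
  proof (cases "A = []")
    case False
    then have "a + 2 + (mnorm A - 1) = mnorm (a # A) - 1"
      using mnorm_eq_0_iff[of A] by (simp del: mnorm_eq_0_iff)
    then show ?thesis
      using Cons[of "\<lambda>m. c (a + 2 + m)" "\<lambda>K. f (a # K)"] by (simp only: mnorm_Cons)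
  qed simp
  then show ?case
    by (simp add: algebra_simps del: mnorm_Cons) (auto simp: Suc_diff_Suc)
qed simp

text \<open>This is the transformed Riccati equation times -(-i)^n n! with n =
  \<open>mnorm A\<close>. The factor -i before \<open>del\<close> compensates the shift of n by one,
  the sign of the product is absorbed by the two factors -i in \<open>coeff_S\<close>, and n \<ge> 3
  keeps away from [0], where the inhomogeneous term sits.\<close>

lemma coeff_CA_rec:
  assumes "mnorm A \<ge> 3"
  shows "coeff_CA A = - \<i> * del coeff_CA A + fact (mnorm A) * conv coeff_S coeff_S A"
proof -
  let ?\<gamma> = "binomial_transform coeff_C" and ?n = "mnorm A"
  have conv: "conv coeff_S coeff_S A = - ((- \<i>) ^ ?n) * conv ?\<gamma> ?\<gamma> A"
  proof -
    have "coeff_S (take t A) * coeff_S (drop t A) = - ((- \<i>) ^ ?n) * (?\<gamma> (take t A) * ?\<gamma> (drop t A))" for t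
    proof -
      have "mnorm (take t A) + mnorm (drop t A) = ?n"
        using mnorm_append[of "take t A" "drop t A"] by simp
      then have "(- \<i>) ^ mnorm (take t A) * (- \<i>) ^ mnorm (drop t A) = (- \<i>) ^ ?n"
        by (metis power_add)
      then show ?thesis
        by (simp add: coeff_S_eq algebra_simps)
    qed
    then show ?thesis
      by (simp add: conv_eq_sum sum_distrib_left)
  qed
  have "- \<i> * del coeff_CA A = - ((- \<i>) ^ ?n) * fact ?n * del ?\<gamma> A"
  proof -
    have "coeff_CA = (\<lambda>K. (- ((- \<i>) ^ mnorm K) * fact (mnorm K + 1)) * ?\<gamma> K)"
      by (simp add: fun_eq_iff coeff_CA_eq)
    then have "del coeff_CA A = - ((- \<i>) ^ (?n - 1)) * fact (?n - 1 + 1) * del ?\<gamma> A"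
      using del_grade_scale[of "\<lambda>n. - ((- \<i>) ^ n) * fact (n + 1)" ?\<gamma>] by simp
    moreover obtain m where "?n = Suc m"
      using assms by (cases ?n) auto
    ultimately show ?thesis
      by simp
  qed
  moreover have "coeff_CA A = - ((- \<i>) ^ ?n) * fact ?n * ((of_nat ?n + 1) * ?\<gamma> A)"
    by (simp add: coeff_CA_eq algebra_simps)
  moreover have "A \<noteq> [0]" using assms by auto
  ultimately show ?thesis
    unfolding binomial_transform_coeff_C_riccati conv by (simp add: algebra_simps)
qed

text \<open>At [0] the equation reads 3 c = -1 for the transform c of C, and the prefactor in C_A is
  there 3!.\<close>

lemma coeff_CA_0: "coeff_CA [0] = - 2"
proof -
  have "3 * binomial_transform coeff_C [0] = - 1"
    using binomial_transform_coeff_C_riccati[of "[0]"] coeff_C_Nil by simp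
  then have "binomial_transform coeff_C [0] = - 1 / 3" by (simp add: field_simps)
  then show ?thesis unfolding coeff_CA_eq by (simp add: fact_numeral eval_nat_numeral)
qed

definition graded_part :: "nat \<Rightarrow> (nat list \<Rightarrow> complex) \<Rightarrow> nat list \<Rightarrow> complex" where
  "graded_part k f A = (if mnorm A = k then f A else 0)"

text \<open>The effect of \<open>id1\<close> on coefficients: its factor i times the minus sign with
  which d_1 acts on (x, y, ..., y).\<close>

definition delta :: "(nat list \<Rightarrow> complex) \<Rightarrow> nat list \<Rightarrow> complex" where
  "delta f = (\<lambda>A. - \<i> * del f A)"

lemma delta_add: "delta (\<lambda>A. f A + g A) = (\<lambda>A. delta f A + delta g A)"
  by (simp add: delta_def del_add algebra_simps)

lemma delta_scale: "delta (\<lambda>A. c * f A) = (\<lambda>A. c * delta f A)"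
  by (simp add: delta_def del_scale algebra_simps)

lemma delta_sum: "delta (\<lambda>A. \<Sum>i\<in>I. f i A) = (\<lambda>A. \<Sum>i\<in>I. delta (f i) A)"
  by (simp add: delta_def del_sum sum_distrib_left)

lemma delta_graded_part: "delta (graded_part k f) = graded_part (k + 1) (delta f)"
proof
  fix A
  have "del (\<lambda>K. (if mnorm K = k then 1 else 0) * f K) A = (if mnorm A - 1 = k then 1 else 0) * del f A"
    using del_grade_scale[of "\<lambda>m. if m = k then 1 else 0"] .
  moreover have "graded_part k f = (\<lambda>K. (if mnorm K = k then 1 else 0) * f K)"
    by (auto simp: graded_part_def)
  ultimately show "delta (graded_part k f) A = graded_part (k + 1) (delta f) A"
    by (cases A) (auto simp: delta_def graded_part_def)
qed

lemma coeff_S_Nil: "coeff_S [] = 0"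
  by (simp add: coeff_S_eq coeff_C_Nil)

lemma mnorm_ge_2: "A \<noteq> [] \<Longrightarrow> mnorm A \<ge> 2"
  by (cases A) auto

text \<open>Nonempty lists have norm at least 2 and \<open>coeff_S\<close> vanishes on the empty
  list, so the pairs p, k - p + 1 with p in {2..k-1} account exactly once for every contributing
  splitting of a list of norm k + 1.\<close>

lemma conv_graded_part_coeff_S:
  "(\<Sum>p=2..k-1. conv (graded_part p coeff_S) (graded_part (k - p + 1) coeff_S) A) = graded_part (k + 1) (conv coeff_S coeff_S) A"
proof -
  have "(\<Sum>p=2..k-1. graded_part p coeff_S (take t A) * graded_part (k - p + 1) coeff_S (drop t A)) =
      (if mnorm A = k + 1 then coeff_S (take t A) * coeff_S (drop t A) else 0)" for t
  proof -
    let ?P = "mnorm (take t A)" and ?Q = "mnorm (drop t A)"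
    have sum: "mnorm A = ?P + ?Q"
      using mnorm_append[of "take t A" "drop t A"] by simp
    show ?thesis
    proof (cases "take t A = [] \<or> drop t A = []")
      case True
      then show ?thesis
        by (elim disjE) (auto simp: graded_part_def coeff_S_Nil)
    next
      case False
      then have ge: "?P \<ge> 2" "?Q \<ge> 2" using mnorm_ge_2 by blast+
      have "(\<Sum>p=2..k-1. graded_part p coeff_S (take t A) * graded_part (k - p + 1) coeff_S (drop t A)) =
          (\<Sum>p=2..k-1. if p = ?P then coeff_S (take t A) * graded_part (k - ?P + 1) coeff_S (drop t A) else 0)"
        by (rule sum.cong) (auto simp: graded_part_def)
      also have "\<dots> = (if ?P \<in> {2..k-1} then coeff_S (take t A) * graded_part (k - ?P + 1) coeff_S (drop t A) else 0)"
        by (simp only: sum.delta finite_atLeastAtMost)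
      also have "\<dots> = (if mnorm A = k + 1 then coeff_S (take t A) * coeff_S (drop t A) else 0)"
      proof (cases "?P \<in> {2..k-1}")
        case True
        then have "?Q = k - ?P + 1 \<longleftrightarrow> mnorm A = k + 1" using sum by auto
        then show ?thesis using True by (simp only: graded_part_def if_True) simp
      next
        case False
        then have "mnorm A \<noteq> k + 1" using sum ge by auto
        then show ?thesis using False by (simp only: if_False)
      qed
      finally show ?thesis .
    qed
  qed
  then show ?thesis
    unfolding conv_eq_sum by (subst sum.swap) (simp add: graded_part_def conv_eq_sum)
qed

lemma graded_part_coeff_CA_rec:
  assumes "k \<ge> 2"
  shows "graded_part (k + 1) coeff_CA = (\<lambda>A. delta (graded_part k coeff_CA) A +
    fact (k + 1) * (\<Sum>p=2..k-1. conv (graded_part p coeff_S) (graded_part (k - p + 1) coeff_S) A))"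
proof
  fix A
  show "graded_part (k + 1) coeff_CA A = delta (graded_part k coeff_CA) A +
    fact (k + 1) * (\<Sum>p=2..k-1. conv (graded_part p coeff_S) (graded_part (k - p + 1) coeff_S) A)"
  proof (cases "mnorm A = k + 1")
    case True
    then have "mnorm A \<ge> 3" using assms by simp
    from coeff_CA_rec[OF this] True show ?thesis
      unfolding conv_graded_part_coeff_S delta_graded_part by (simp add: graded_part_def delta_def)
  next
    case False
    then show ?thesis
      unfolding conv_graded_part_coeff_S delta_graded_part by (simp add: graded_part_def)
  qed
qed

text \<open>Iterating the one step recursion down to degree 2 reproduces the shape of Theta_k: the
  quadratic term that arises in passing from degree r to r + 1 is differentiated k - 1 - r more
  times.\<close>

lemma graded_part_coeff_CA_unrolled:
  assumes "k \<ge> 3"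
  shows "graded_part k coeff_CA = (\<lambda>A. (delta ^^ (k - 3)) (delta (graded_part 2 coeff_CA)) A +
    (\<Sum>r=3..k-1. fact (r + 1) *
      (\<Sum>p=2..r-1. (delta ^^ (k - 1 - r)) (conv (graded_part p coeff_S) (graded_part (r - p + 1) coeff_S)) A)))"
  using assms
proof (induction k rule: dec_induct)
  case base
  \<comment> \<open>For degree 2 the quadratic sum is empty, so degree 3 consists of the derivative
    alone.\<close>
  show ?case using graded_part_coeff_CA_rec[of 2] by (simp add: numeral_eq_Suc)
next
  case (step k)
  have k: "Suc k - 3 = Suc (k - 3)" using step by simp
  have rec: "graded_part (Suc k) coeff_CA = (\<lambda>A. delta (graded_part k coeff_CA) A +
      fact (k + 1) * (\<Sum>p=2..k-1. conv (graded_part p coeff_S) (graded_part (k - p + 1) coeff_S) A))"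
    using graded_part_coeff_CA_rec[of k] step by simp
  have "(delta ^^ (k - r)) f = delta ((delta ^^ (k - 1 - r)) f)" if "r \<in> {3..k-1}" for r f
  proof -
    have "k - r = Suc (k - 1 - r)" using that by auto
    then show ?thesis by simp
  qed
  then have delta: "delta (graded_part k coeff_CA) = (\<lambda>A. (delta ^^ (Suc k - 3)) (delta (graded_part 2 coeff_CA)) A +
    (\<Sum>r=3..k-1. fact (r + 1) *
      (\<Sum>p=2..r-1. (delta ^^ (k - r)) (conv (graded_part p coeff_S) (graded_part (r - p + 1) coeff_S)) A)))"
    unfolding step.IH k delta_add delta_sum delta_scale by (auto intro!: sum.cong simp: fun_eq_iff)
  have "{3..Suc k - 1} = insert k {3..k-1}" "k \<notin> {3..k-1}" using step by auto
  then have sum: "(\<Sum>r=3..Suc k-1. F r) = F k + (\<Sum>r=3..k-1. F r)" for F :: "nat \<Rightarrow> complex"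
    by simp
  show ?case
    unfolding rec delta sum by (simp add: fun_eq_iff del: fact_Suc)
qed

section \<open>Smooth functions and vector fields\<close>

lemma Ck_on_const: "Ck_on n k V (\<lambda>x. c)"
proof (induction k arbitrary: c)
  case (Suc k)
  show ?case using Suc[of 0] by auto
qed auto

lemma Ck_on_add: "Ck_on n k V f \<Longrightarrow> Ck_on n k V g \<Longrightarrow> Ck_on n k V (\<lambda>x. f x + g x)"
proof (induction k arbitrary: f g)
  case (Suc k)
  have "\<exists>h. Ck_on n k V h \<and>
      (\<forall>x\<in>V. ((\<lambda>t. f (x(i := t)) + g (x(i := t))) has_vector_derivative h x) (at (x i)))"
    if i: "i < n" for i
  proof -
    obtain f' g' where "Ck_on n k V f'" "Ck_on n k V g'"
      "\<forall>x\<in>V. ((\<lambda>t. f (x(i := t))) has_vector_derivative f' x) (at (x i))"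
      "\<forall>x\<in>V. ((\<lambda>t. g (x(i := t))) has_vector_derivative g' x) (at (x i))"
      using Suc.prems i by (auto, blast)
    then show ?thesis
      by (intro exI[of _ "\<lambda>x. f' x + g' x"]) (auto intro: Suc.IH has_vector_derivative_add)
  qed
  then show ?case
    using Suc.prems by (auto intro: continuous_map_add)
qed (auto intro: continuous_map_add)

lemma Ck_on_mult_const:
  fixes f :: "_ \<Rightarrow> 'b::real_normed_algebra"
  shows "Ck_on n k V f \<Longrightarrow> Ck_on n k V (\<lambda>x. c * f x)"
proof (induction k arbitrary: f)
  case 0
  then have "continuous_map (subtopology (Euclidean_space n) V) euclidean ((\<lambda>y. c * y) \<circ> f)"
    by (intro continuous_map_compose[where X' = euclidean]) (auto intro: continuous_intros)
  then show ?case by (simp add: o_def)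
next
  case (Suc k)
  have "\<exists>h. Ck_on n k V h \<and> (\<forall>x\<in>V. ((\<lambda>t. c * f (x(i := t))) has_vector_derivative h x) (at (x i)))"
    if i: "i < n" for i
  proof -
    obtain f' where "Ck_on n k V f'"
      "\<forall>x\<in>V. ((\<lambda>t. f (x(i := t))) has_vector_derivative f' x) (at (x i))"
      using Suc.prems i by auto
    then show ?thesis
      by (intro exI[of _ "\<lambda>x. c * f' x"]) (auto intro: Suc.IH has_vector_derivative_mult_right)
  qed
  moreover have "continuous_map (subtopology (Euclidean_space n) V) euclidean ((\<lambda>y. c * y) \<circ> f)"
    using Suc.prems by (intro continuous_map_compose[where X' = euclidean]) (auto intro: continuous_intros)
  ultimately show ?case by (simp add: o_def)
qed

lemma smooth_fun_const: "smooth_fun n \<A> (\<lambda>p. c)"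
  by (auto simp: smooth_fun_def smooth_on_def Ck_on_const)

lemma smooth_fun_add: "smooth_fun n \<A> f \<Longrightarrow> smooth_fun n \<A> g \<Longrightarrow> smooth_fun n \<A> (\<lambda>p. f p + g p)"
  by (auto simp: smooth_fun_def smooth_on_def intro!: Ck_on_add)

lemma smooth_fun_mult_const:
  fixes f :: "'a \<Rightarrow> 'b::real_normed_algebra"
  shows "smooth_fun n \<A> f \<Longrightarrow> smooth_fun n \<A> (\<lambda>p. c * f p)"
  by (auto simp: smooth_fun_def smooth_on_def intro!: Ck_on_mult_const)

lemma tangent_space_add:
  "u \<in> tangent_space n \<A> p \<Longrightarrow> v \<in> tangent_space n \<A> p \<Longrightarrow> (\<lambda>f. u f + v f) \<in> tangent_space n \<A> p"
  by (simp add: tangent_space_def algebra_simps)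

lemma tangent_space_scale: "v \<in> tangent_space n \<A> p \<Longrightarrow> (\<lambda>f. r * v f) \<in> tangent_space n \<A> p"
  by (simp add: tangent_space_def algebra_simps)

text \<open>The Leibniz rule for 1 = 1 * 1 forces the value at 1 to be 0. This is what makes a
  connection linear over complex constants.\<close>

lemma tangent_space_const:
  assumes "v \<in> tangent_space n \<A> p"
  shows "v (\<lambda>x. r) = 0"
proof -
  have "v (\<lambda>x. 1 * 1) = 1 * v (\<lambda>x. 1) + 1 * v (\<lambda>x. 1)"
    using assms smooth_fun_const unfolding tangent_space_def by blast
  moreover have "v (\<lambda>x. r * 1) = r * v (\<lambda>x. 1)"
    using assms smooth_fun_const unfolding tangent_space_def by blast
  ultimately show ?thesis by simp
qed

lemma ctangent_space_zero: "0 \<in> ctangent_space n \<A> p"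
  by (simp add: ctangent_space_def tangent_space_def)

lemma ctangent_space_add: "u \<in> ctangent_space n \<A> p \<Longrightarrow> v \<in> ctangent_space n \<A> p \<Longrightarrow> u + v \<in> ctangent_space n \<A> p"
  by (simp add: ctangent_space_def tangent_space_add)

lemma ctangent_space_scale:
  assumes "v \<in> ctangent_space n \<A> p"
  shows "vscale c v \<in> ctangent_space n \<A> p"
proof -
  have re: "(\<lambda>f. Re (vscale c v f)) = (\<lambda>f. Re c * Re (v f) + (- Im c) * Im (v f))"
    and im: "(\<lambda>f. Im (vscale c v f)) = (\<lambda>f. Re c * Im (v f) + Im c * Re (v f))"
    by (auto simp: vscale_def)
  show ?thesis
    using assms unfolding ctangent_space_def mem_Collect_eq re im
    by (intro conjI tangent_space_add tangent_space_scale) auto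
qed

lemma cact_const: "v \<in> ctangent_space n \<A> p \<Longrightarrow> cact v (\<lambda>x. c) = 0"
  using tangent_space_const[of "\<lambda>f. Re (v f)"] tangent_space_const[of "\<lambda>f. Im (v f)"]
  by (auto simp: cact_def ctangent_space_def complex_eq_iff)

abbreviation cscale :: "complex \<Rightarrow> 'a vfield \<Rightarrow> 'a vfield" where
  "cscale c X \<equiv> fscale (\<lambda>_. c) X"

lemma cscale_apply: "cscale c X p f = c * X p f"
  by (simp add: fscale_def vscale_def)

global_interpretation vfield: vector_space "cscale :: complex \<Rightarrow> 'a vfield \<Rightarrow> 'a vfield"
  by unfold_locales (auto simp: fun_eq_iff cscale_apply algebra_simps)

lemma vfields_zero: "0 \<in> vfields n \<A>"
  by (simp add: vfields_def ctangent_space_zero smooth_fun_const)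

lemma vfields_add: "X \<in> vfields n \<A> \<Longrightarrow> Y \<in> vfields n \<A> \<Longrightarrow> X + Y \<in> vfields n \<A>"
  by (simp add: vfields_def ctangent_space_add smooth_fun_add)

lemma vfields_cscale:
  assumes "X \<in> vfields n \<A>"
  shows "cscale c X \<in> vfields n \<A>"
proof -
  have "cscale c X p = vscale c (X p)" for p by (simp add: fscale_def)
  then show ?thesis
    unfolding vfields_def mem_Collect_eq cscale_apply
    using assms by (simp add: vfields_def ctangent_space_scale smooth_fun_mult_const)
qed

lemma vfields_diff: "X \<in> vfields n \<A> \<Longrightarrow> Y \<in> vfields n \<A> \<Longrightarrow> X - Y \<in> vfields n \<A>"
  using vfields_add[OF _ vfields_cscale[of Y n \<A> "- 1"], of X] by simp

lemma vfields_sum: "(\<And>i. i \<in> I \<Longrightarrow> X i \<in> vfields n \<A>) \<Longrightarrow> (\<Sum>i\<in>I. X i) \<in> vfields n \<A>"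
  by (induction I rule: infinite_finite_induct) (auto intro: vfields_zero vfields_add)

lemmas vfields_closed = vfields_zero vfields_add vfields_cscale vfields_diff vfields_sum

section \<open>Multilinear operators and polarization\<close>

text \<open>Linearity is over complex constants, the form in which polarization uses it. The single
  law for \<open>cscale c X + Y\<close> covers sums and multiples, and values in the smooth fields
  are demanded so that operators can be inserted into each other.\<close>

definition multilinear_op :: "nat \<Rightarrow> 'a chart set \<Rightarrow> nat \<Rightarrow> 'a tensor_op \<Rightarrow> bool" where
  "multilinear_op n \<A> m F \<longleftrightarrow> (\<forall>Xs\<in>lists (vfields n \<A>). length Xs = m \<longrightarrow> F Xs \<in> vfields n \<A> \<and>
     (\<forall>i<m. \<forall>X\<in>vfields n \<A>. \<forall>Y\<in>vfields n \<A>. \<forall>c.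
        F (Xs[i := cscale c X + Y]) = cscale c (F (Xs[i := X])) + F (Xs[i := Y])))"

lemma mset_update_replicate:
  "i < k \<Longrightarrow> mset ((replicate k y)[i := z]) = mset (z # replicate (k - 1) y)"
proof -
  assume "i < k"
  moreover from this have "replicate_mset k y - {#y#} = replicate_mset (k - 1) y"
    by (cases k) auto
  ultimately show ?thesis by (simp add: mset_update)
qed

lemma lists_update: "Xs \<in> lists V \<Longrightarrow> X \<in> V \<Longrightarrow> Xs[i := X] \<in> lists V"
  using set_update_subset_insert[of Xs i X] by auto

lemma replicate_in_lists: "x \<in> V \<Longrightarrow> replicate k x \<in> lists V"
  by auto

lemma nth_in_lists: "Xs \<in> lists V \<Longrightarrow> i < length Xs \<Longrightarrow> Xs ! i \<in> V"
  by (auto simp: lists_eq_set)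

lemma take_in_lists: "Xs \<in> lists V \<Longrightarrow> take i Xs \<in> lists V"
  using set_take_subset by (fastforce simp: lists_eq_set)

lemma drop_in_lists: "Xs \<in> lists V \<Longrightarrow> drop i Xs \<in> lists V"
  using set_drop_subset by (fastforce simp: lists_eq_set)

lemmas in_lists_intros = lists_update replicate_in_lists nth_in_lists take_in_lists drop_in_lists

text \<open>Otherwise the simplifier eta-expands sums of vector fields to functions of a point and a function.\<close>

declare plus_fun_apply [simp del] zero_fun_apply [simp del] minus_apply [simp del] uminus_apply [simp del]

locale charted =
  fixes n :: nat and \<A> :: "'a::{t2_space, second_countable_topology} chart set"
begin

abbreviation "V \<equiv> vfields n \<A>"

abbreviation "ml \<equiv> multilinear_op n \<A>"

lemmas V_closed = vfields_closed[where n = n and \<A> = \<A>]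

lemma ml_value: "ml m F \<Longrightarrow> Xs \<in> lists V \<Longrightarrow> length Xs = m \<Longrightarrow> F Xs \<in> V"
  by (simp add: multilinear_op_def)

lemma ml_update:
  "ml m F \<Longrightarrow> Xs \<in> lists V \<Longrightarrow> length Xs = m \<Longrightarrow> i < m \<Longrightarrow> X \<in> V \<Longrightarrow> Y \<in> V \<Longrightarrow>
   F (Xs[i := cscale c X + Y]) = cscale c (F (Xs[i := X])) + F (Xs[i := Y])"
  by (simp add: multilinear_op_def)

lemma mlI:
  assumes "\<And>Xs. Xs \<in> lists V \<Longrightarrow> length Xs = m \<Longrightarrow> F Xs \<in> V"
    and "\<And>Xs i c X Y. Xs \<in> lists V \<Longrightarrow> length Xs = m \<Longrightarrow> i < m \<Longrightarrow> X \<in> V \<Longrightarrow> Y \<in> V \<Longrightarrow>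
     F (Xs[i := cscale c X + Y]) = cscale c (F (Xs[i := X])) + F (Xs[i := Y])"
  shows "ml m F"
  using assms by (simp add: multilinear_op_def)

lemma ml_add: "ml m F \<Longrightarrow> ml m G \<Longrightarrow> ml m (\<lambda>Xs. F Xs + G Xs)"
  by (rule mlI) (auto intro: V_closed ml_value simp: ml_update[of m F] ml_update[of m G] vfield.scale_right_distrib)

lemma ml_cscale: "ml m F \<Longrightarrow> ml m (\<lambda>Xs. cscale c (F Xs))"
  by (rule mlI) (auto intro: V_closed ml_value simp: ml_update[of m F] vfield.scale_right_distrib mult.commute)

lemma ml_diff: "ml m F \<Longrightarrow> ml m G \<Longrightarrow> ml m (\<lambda>Xs. F Xs - G Xs)"
  using ml_add[OF _ ml_cscale[of m G "- 1"], of F] by simp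

lemma ml_zero: "ml m (\<lambda>Xs. 0)"
  by (rule mlI) (auto intro: V_closed)

lemma ml_sum: "(\<And>i. i \<in> I \<Longrightarrow> ml m (F i)) \<Longrightarrow> ml m (\<lambda>Xs. \<Sum>i\<in>I. F i Xs)"
  by (induction I rule: infinite_finite_induct) (auto intro: ml_add ml_zero)

lemma ml_cong: "ml m F \<Longrightarrow> (\<And>Xs. Xs \<in> lists V \<Longrightarrow> length Xs = m \<Longrightarrow> G Xs = F Xs) \<Longrightarrow> ml m G"
  by (rule mlI) (simp_all add: ml_value ml_update[of m F] lists_update V_closed del: in_lists_conv_set)

lemma ml_zero_entry:
  assumes "ml m F" "Xs \<in> lists V" "length Xs = m" "i < m"
  shows "F (Xs[i := 0]) = 0"
proof -
  have "F (Xs[i := cscale (-1) 0 + 0]) = cscale (-1) (F (Xs[i := 0])) + F (Xs[i := 0])"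
    using assms V_closed(1) by (intro ml_update[OF assms])
  then show ?thesis by simp
qed

lemma ml_Cons:
  assumes "ml (Suc k) F" "x \<in> V"
  shows "ml k (\<lambda>Ys. F (x # Ys))"
proof (rule mlI)
  fix Xs i c X Y assume "Xs \<in> lists V" "length Xs = k" "i < k" "X \<in> V" "Y \<in> V"
  then show "F (x # Xs[i := cscale c X + Y]) = cscale c (F (x # Xs[i := X])) + F (x # Xs[i := Y])"
    using ml_update[OF assms(1), of "x # Xs" "Suc i" X Y c] assms(2) by simp
next
  fix Xs assume "Xs \<in> lists V" "length Xs = k"
  then show "F (x # Xs) \<in> V" using assms by (intro ml_value[of "Suc k"]) auto
qed

text \<open>Linearization is a derivative at \<open>0\<close>, and a form vanishing on the diagonal has zero derivative.\<close>

lemma ml_deriv: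
  assumes "ml (length us + m) F" "us \<in> lists V" "y \<in> V" "z \<in> V"
  shows "((\<lambda>t. F (us @ replicate m (cscale t z + y)) p f) has_field_derivative
    (\<Sum>i<m. F (us @ (replicate m y)[i := z])) p f) (at 0)"
  using assms(1,2)
proof (induction m arbitrary: us)
  case (Suc m)
  let ?w = "\<lambda>t. cscale t z + y"
  \<comment> \<open>Expanding one entry and moving it into the prefix \<open>us\<close> leaves t
    G(t) + H(t), whose derivative at 0 is G(0) + H'(0). Evaluation at \<open>p\<close> and
    \<open>f\<close> makes G and H complex functions of t.\<close>
  have 1: "F (us @ replicate (Suc m) (?w t)) p f =
      t * F ((us @ [z]) @ replicate m (?w t)) p f + F ((us @ [y]) @ replicate m (?w t)) p f" for t
  proof -
    let ?Xs = "\<lambda>u. us @ u # replicate m (?w t)"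
    have upd: "(?Xs 0)[length us := u] = ?Xs u" for u by simp
    have "?w t \<in> V" using assms by (intro V_closed)
    then have "F ((?Xs 0)[length us := ?w t]) = cscale t (F ((?Xs 0)[length us := z])) + F ((?Xs 0)[length us := y])"
      using Suc.prems assms \<open>?w t \<in> V\<close> V_closed(1) by (intro ml_update[OF Suc.prems(1)]) auto
    then show ?thesis unfolding upd by (simp add: cscale_apply plus_fun_apply)
  qed
  have IH: "((\<lambda>t. F ((us @ [u]) @ replicate m (?w t)) p f) has_field_derivative
      (\<Sum>i<m. F ((us @ [u]) @ (replicate m y)[i := z])) p f) (at 0)" if "u \<in> V" for u
    using Suc.prems that by (intro Suc.IH) auto
  have "((\<lambda>t. t * F ((us @ [z]) @ replicate m (?w t)) p f + F ((us @ [y]) @ replicate m (?w t)) p f)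
      has_field_derivative
      1 * F ((us @ [z]) @ replicate m (?w 0)) p f + (\<Sum>i<m. F ((us @ [z]) @ (replicate m y)[i := z])) p f * 0 +
      (\<Sum>i<m. F ((us @ [y]) @ (replicate m y)[i := z])) p f) (at 0)"
    by (intro DERIV_add DERIV_mult IH DERIV_ident assms)
  then show ?case
    unfolding 1 by (simp add: plus_fun_apply sum.lessThan_Suc_shift del: sum.lessThan_Suc)
qed (simp add: zero_fun_apply)

lemma ml_linearize:
  assumes "ml k F" "\<And>y. y \<in> V \<Longrightarrow> F (replicate k y) = 0" "y \<in> V" "z \<in> V"
  shows "(\<Sum>i<k. F ((replicate k y)[i := z])) = 0"
proof (intro ext)
  fix p f
  have "((\<lambda>t. F ([] @ replicate k (cscale t z + y)) p f) has_field_derivative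
    (\<Sum>i<k. F ([] @ (replicate k y)[i := z])) p f) (at 0)"
    by (rule ml_deriv) (use assms in auto)
  moreover have "F (replicate k (cscale t z + y)) = 0" for t
    using assms by (intro assms(2) V_closed)
  ultimately have "((\<lambda>t. 0) has_field_derivative (\<Sum>i<k. F ((replicate k y)[i := z])) p f) (at 0)"
    by (simp add: zero_fun_apply)
  then show "(\<Sum>i<k. F ((replicate k y)[i := z])) p f = 0 p f"
    using DERIV_unique[OF _ DERIV_const] by (fastforce simp: zero_fun_apply)
qed

lemma ml_linearize_cong:
  assumes "ml k F" "ml k G" "\<And>y. y \<in> V \<Longrightarrow> F (replicate k y) = G (replicate k y)" "y \<in> V" "z \<in> V"
  shows "(\<Sum>i<k. F ((replicate k y)[i := z])) = (\<Sum>i<k. G ((replicate k y)[i := z]))"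
  using ml_linearize[OF ml_diff[OF assms(1,2)], of y z] assms(3-5) by (simp add: sum_subtractf)

text \<open>Linearizing F(y, ..., y) = 0 in the direction z gives a sum of terms that symmetry makes
  equal, so F(z, y, ..., y) = 0. Hence F(z, ...) is again symmetric and zero on the diagonal, with
  one entry less.\<close>

lemma symmetric_ml_polarization:
  assumes "ml k F" "\<And>y. y \<in> V \<Longrightarrow> F (replicate k y) = 0"
    and "\<And>Xs Ys. Xs \<in> lists V \<Longrightarrow> length Xs = k \<Longrightarrow> mset Xs = mset Ys \<Longrightarrow> F Xs = F Ys"
    and "Xs \<in> lists V" "length Xs = k"
  shows "F Xs = 0"
  using assms
proof (induction k arbitrary: F Xs)
  case 0
  have "F (replicate 0 0) = 0" by (rule 0(2)) (rule V_closed)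
  then show ?case using \<open>length Xs = 0\<close> by simp
next
  case (Suc k)
  obtain z Zs where Xs: "Xs = z # Zs" using Suc.prems by (cases Xs) auto
  have z: "z \<in> V" and Zs: "Zs \<in> lists V" "length Zs = k" using Suc.prems Xs by auto
  have "F (z # Zs) = 0"
  proof (rule Suc.IH[of "\<lambda>Ys. F (z # Ys)"])
    show "ml k (\<lambda>Ys. F (z # Ys))" using Suc.prems(1) z by (rule ml_Cons)
    show "F (z # replicate k y) = 0" if y: "y \<in> V" for y
    proof -
      have "F ((replicate (Suc k) y)[i := z]) = F (z # replicate k y)" if "i < Suc k" for i
        using mset_update_replicate[OF that, of y z] y z
        by (intro Suc.prems(3) in_lists_intros) (auto simp del: replicate_Suc)
      then have "(\<Sum>i<Suc k. F ((replicate (Suc k) y)[i := z])) = (\<Sum>i<Suc k. F (z # replicate k y))"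
        by (intro sum.cong) auto
      then have "0 = (\<Sum>i<Suc k. F (z # replicate k y))"
        using ml_linearize[OF Suc.prems(1,2) y z] by simp
      also have "\<dots> = cscale (of_nat (Suc k)) (F (z # replicate k y))"
        by (simp only: vfield.sum_constant_scale card_lessThan)
      finally show ?thesis
        by (metis of_nat_neq_0 vfield.scale_eq_0_iff)
    qed
    show "F (z # Ys) = F (z # Ys')" if "Ys \<in> lists V" "length Ys = k" "mset Ys = mset Ys'" for Ys Ys'
      using that z by (intro Suc.prems(3)) auto
  qed (use Zs in auto)
  then show ?case using Xs by simp
qed

end

section \<open>Covariant derivatives of multilinear operators\<close>

locale connection = charted n \<A>
  for n :: nat and \<A> :: "'a::{t2_space, second_countable_topology} chart set" +
  fixes D :: "'a vfield \<Rightarrow> 'a vfield \<Rightarrow> 'a vfield"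
  assumes covariant: "complex_covariant_derivative n \<A> D"
    and torsion: "torsion_free n \<A> D"
begin

lemma D_V: "X \<in> V \<Longrightarrow> Y \<in> V \<Longrightarrow> D X Y \<in> V"
  using covariant by (simp add: complex_covariant_derivative_def)

lemma D_linear_left:
  assumes "X \<in> V" "Z \<in> V" "Y \<in> V"
  shows "D (cscale c X + Z) Y = cscale c (D X Y) + D Z Y"
proof -
  have "D (cscale c X + Z) Y = D (cscale c X) Y + D Z Y"
    using covariant assms vfields_cscale[OF assms(1)] unfolding complex_covariant_derivative_def by blast
  moreover have "D (cscale c X) Y = cscale c (D X Y)"
    using covariant assms smooth_fun_const unfolding complex_covariant_derivative_def by blast
  ultimately show ?thesis by simp
qed

lemma D_linear_right:
  assumes "X \<in> V" "Z \<in> V" "Y \<in> V"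
  shows "D X (cscale c Y + Z) = cscale c (D X Y) + D X Z"
proof -
  have "D X (cscale c Y + Z) = D X (cscale c Y) + D X Z"
    using covariant assms vfields_cscale[OF assms(3)] unfolding complex_covariant_derivative_def by blast
  moreover have "D X (cscale c Y) = fscale (\<lambda>p. cact (X p) (\<lambda>_. c)) Y + cscale c (D X Y)"
    using covariant assms smooth_fun_const unfolding complex_covariant_derivative_def by blast
  moreover have "cact (X p) (\<lambda>_. c) = 0" for p
    using assms by (intro cact_const[of _ n \<A> p]) (simp add: vfields_def)
  ultimately show ?thesis by simp
qed

lemma D_zero_right: "X \<in> V \<Longrightarrow> D X 0 = 0"
  using D_linear_right[of X 0 0 "- 1"] V_closed(1) by simp

lemma D_cscale_right: "X \<in> V \<Longrightarrow> Y \<in> V \<Longrightarrow> D X (cscale c Y) = cscale c (D X Y)"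
  using D_linear_right[of X 0 Y c] V_closed(1) by (simp add: D_zero_right)

lemma D_add_right: "X \<in> V \<Longrightarrow> Y \<in> V \<Longrightarrow> Z \<in> V \<Longrightarrow> D X (Y + Z) = D X Y + D X Z"
  using D_linear_right[of X Z Y 1] by simp

lemma D_sum_right:
  assumes "X \<in> V" "\<And>i. i \<in> I \<Longrightarrow> Y i \<in> V"
  shows "D X (\<Sum>i\<in>I. Y i) = (\<Sum>i\<in>I. D X (Y i))"
  using assms(2)
proof (induction I rule: infinite_finite_induct)
  case (insert i I)
  then show ?case using assms(1) by (simp add: D_add_right V_closed)
qed (use assms(1) in \<open>auto simp: D_zero_right\<close>)

lemma lie_bracket_eq: "X \<in> V \<Longrightarrow> Y \<in> V \<Longrightarrow> lie_bracket X Y = D X Y - D Y X"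
  using torsion by (simp add: torsion_free_def)

lemma ml_nabla:
  assumes A: "ml m A"
  shows "ml (Suc m) (nabla D A)"
proof (rule mlI)
  fix Xs assume "Xs \<in> lists V" "length Xs = Suc m"
  then obtain X Ys where Xs: "Xs = X # Ys" "X \<in> V" "Ys \<in> lists V" "length Ys = m" by (cases Xs) auto
  have "D X (A Ys) - (\<Sum>i<m. A (Ys[i := D X (Ys ! i)])) \<in> V"
    by (intro V_closed D_V ml_value[OF A] lists_update nth_in_lists Xs) (auto simp: Xs)
  then show "nabla D A Xs \<in> V" using Xs by simp
next
  fix Xs i c Y Z assume Xs: "Xs \<in> lists V" "length Xs = Suc m" and i: "i < Suc m" and Y: "Y \<in> V" "Z \<in> V"
  then obtain W Ws where Ws: "Xs = W # Ws" "W \<in> V" "Ws \<in> lists V" "length Ws = m" by (cases Xs) auto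
  show "nabla D A (Xs[i := cscale c Y + Z]) = cscale c (nabla D A (Xs[i := Y])) + nabla D A (Xs[i := Z])"
  proof (cases i)
    case 0
    have "A (Ws[j := D (cscale c Y + Z) (Ws ! j)]) = cscale c (A (Ws[j := D Y (Ws ! j)])) + A (Ws[j := D Z (Ws ! j)])"
      if "j < m" for j
      using that Ws Y by (simp add: D_linear_left nth_in_lists ml_update[OF A] D_V del: in_lists_conv_set)
    then show ?thesis
      using Ws Y 0 by (simp add: D_linear_left ml_value[OF A] sum.distrib vfield.scale_sum_right
          vfield.scale_right_diff_distrib del: in_lists_conv_set)
  next
    case (Suc i')
    let ?T = "\<lambda>U j. A (Ws[i' := U, j := D W (Ws[i' := U] ! j)])"
    have i': "i' < m" using Suc i by simp
    \<comment> \<open>If the derivative hits the varied entry, linearity of \<open>D W\<close> is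
      used; otherwise the two updates concern different slots and commute.\<close>
    have "?T (cscale c Y + Z) j = cscale c (?T Y j) + ?T Z j" if j: "j < m" for j
    proof (cases "j = i'")
      case True
      then show ?thesis
        using Ws Y i' by (simp add: D_linear_right ml_update[OF A] D_V del: in_lists_conv_set)
    next
      case False
      then have "?T U j = A ((Ws[j := D W (Ws ! j)])[i' := U])" for U
        using j by (simp add: list_update_swap)
      then show ?thesis
        using Ws Y i' j by (simp add: ml_update[OF A] lists_update D_V nth_in_lists del: in_lists_conv_set)
    qed
    moreover have "A (Ws[i' := cscale c Y + Z]) = cscale c (A (Ws[i' := Y])) + A (Ws[i' := Z])"
      using Ws Y i' by (intro ml_update[OF A])
    moreover have "A (Ws[i' := U]) \<in> V" if "U \<in> V" for U
      using Ws that by (intro ml_value[OF A] lists_update) auto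
    ultimately show ?thesis
      using Ws Y Suc by (simp add: D_linear_right sum.distrib vfield.scale_sum_right
          vfield.scale_right_diff_distrib del: in_lists_conv_set)
  qed
qed

text \<open>Torsion freeness writes the curvature with \<open>D\<close> alone, so that its
  multilinearity reduces to that of \<open>D\<close>.\<close>

lemma curvature_eq:
  "X \<in> V \<Longrightarrow> Y \<in> V \<Longrightarrow> curvature D [X, Y, Z] = D X (D Y Z) - D Y (D X Z) - D (D X Y - D Y X) Z"
  by (simp add: lie_bracket_eq)

lemma ml_curvature: "ml 3 (curvature D)"
proof (rule mlI)
  fix Xs :: "'a vfield list" assume *: "Xs \<in> lists V" "length Xs = 3"
  then obtain X Y Z where Xs: "Xs = [X, Y, Z]" by (auto simp: length_Suc_conv numeral_eq_Suc)
  with * have V: "X \<in> V" "Y \<in> V" "Z \<in> V" by auto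
  then show "curvature D Xs \<in> V"
    unfolding Xs by (subst curvature_eq) (auto intro!: V_closed D_V)
  fix i :: nat and c S T assume i: "i < 3" and ST: "S \<in> V" "T \<in> V"
  have left: "D (X - Y) Z = D X Z - D Y Z" if "X \<in> V" "Y \<in> V" "Z \<in> V" for X Y Z
    using D_linear_left[of Y X Z "- 1"] that by simp
  consider "i = 0" | "i = 1" | "i = 2" using i by linarith
  then show "curvature D (Xs[i := cscale c S + T]) = cscale c (curvature D (Xs[i := S])) + curvature D (Xs[i := T])"
    by cases (use V ST in \<open>simp_all add: Xs curvature_eq V_closed D_V D_linear_left D_linear_right left
        vfield.scale_right_diff_distrib del: curvature.simps\<close>)
qed

lemma nabla_curv_Suc: "nabla_curv D (Suc a) = nabla D (nabla_curv D a)"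
  by (simp add: nabla_curv_def)

lemma ml_nabla_curv: "ml (a + 3) (nabla_curv D a)"
proof (induction a)
  case 0
  then show ?case using ml_curvature by (simp add: nabla_curv_def)
next
  case (Suc a)
  then show ?case using ml_nabla[of "a + 3"] by (simp add: nabla_curv_Suc)
qed

text \<open>The leading term is D_x applied to 0, and the subtracted terms form the derivative of y
  \<mapsto> A(y, ..., y) = 0 in the direction D_x y.\<close>

lemma nabla_diag_zero:
  assumes "ml m A" "\<And>y. y \<in> V \<Longrightarrow> A (replicate m y) = 0" "x \<in> V" "y \<in> V"
  shows "nabla D A (x # replicate m y) = 0"
proof -
  have "(\<Sum>i<m. A ((replicate m y)[i := D x (replicate m y ! i)])) = (\<Sum>i<m. A ((replicate m y)[i := D x y]))"
    by (rule sum.cong) auto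
  also have "\<dots> = 0"
    using assms D_V by (intro ml_linearize[of m]) auto
  finally show ?thesis
    using assms by (simp add: D_zero_right)
qed

lemma nabla_curv_diag_zero: "y \<in> V \<Longrightarrow> nabla_curv D a (replicate (a + 3) y) = 0"
proof (induction a arbitrary: y)
  case 0
  have "D (D y y - D y y) y = 0"
    using D_linear_left[of 0 0 y "- 1"] V_closed(1) 0 by simp
  then show ?case
    using 0 curvature_eq[of y y y] by (simp add: nabla_curv_def numeral_eq_Suc)
next
  case (Suc a)
  then show ?case
    using nabla_diag_zero[OF ml_nabla_curv Suc.IH, of y y]
    by (simp only: nabla_curv_Suc add_Suc replicate_Suc)
qed

end

section \<open>The curvature compositions\<close>

lemma finite_mnorm: "finite {E. mnorm E = k}"
proof -
  have "length E \<le> mnorm E \<and> set E \<subseteq> {..mnorm E}" for E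
    by (induction E) (auto simp: subset_iff intro: le_trans)
  then have "{E. mnorm E = k} \<subseteq> {E. set E \<subseteq> {..k} \<and> length E \<le> k}" by blast
  then show ?thesis
    using finite_lists_length_le[of "{..k}" k] finite_subset by blast
qed

lemma length_le_mnorm: "length E \<le> mnorm E"
  by (induction E) auto

lemma mnorm_upto_Cons: "mnorm_upto (a # E) (Suc j) = a + 1 + mnorm_upto E j"
  by (simp add: mnorm_upto_def)

lemma mnorm_upto_le: "j \<le> length E \<Longrightarrow> mnorm_upto E j \<le> mnorm E"
  using sum_list_take_le[of j E] by (simp add: mnorm_def mnorm_upto_def)

lemma mnorm_update_Suc: "j < length E \<Longrightarrow> mnorm (E[j := Suc (E ! j)]) = mnorm E + 1"
  by (induction E arbitrary: j) (auto split: nat.splits)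

lemma mnorm_update_pred: "j < length E \<Longrightarrow> E ! j \<noteq> 0 \<Longrightarrow> mnorm (E[j := E ! j - 1]) + 1 = mnorm E"
  by (induction E arbitrary: j) (auto split: nat.splits simp: nth_Cons')

lemma mnorm_update_pred': "j < length E \<Longrightarrow> E ! j \<noteq> 0 \<Longrightarrow> mnorm (E[j := E ! j - 1]) = mnorm E - 1"
  using mnorm_update_pred[of j E] by simp

lemma del_eq_sum: "del c G = (\<Sum>j<length G. if G ! j = 0 then 0 else c (G[j := G ! j - 1]))"
proof (induction G arbitrary: c)
  case (Cons a G)
  show ?case
    unfolding del.simps Cons list.size add_Suc_right add_0_right sum.lessThan_Suc_shift by (simp cong: if_cong)
qed simp

text \<open>The outermost factor of \<open>R\<^sup>A\<close>, \<open>A\<close> being \<open>\<nabla>\<^sup>a R\<close>; \<open>m + 1\<close> is the number of entries of \<open>B\<close>.\<close>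

definition insert_block :: "'a tensor_op \<Rightarrow> nat \<Rightarrow> nat \<Rightarrow> 'a tensor_op \<Rightarrow> 'a tensor_op" where
  "insert_block A a m B Xs =
     A (take (a + 1) (tl Xs) @ [B (hd Xs # take m (drop (a + 1) (tl Xs))), tl Xs ! (a + 1 + m)])"

lemma insert_block_diag:
  "insert_block A a m B (x # replicate (a + m + 2) y) = A (replicate (a + 1) y @ [B (x # replicate m y), y])"
  by (simp add: insert_block_def min_def del: replicate_Suc)

lemma map_upt_shift: "map (\<lambda>r. f (r + c)) [i..<j] = map f [i + c..<j + (c::nat)]"
  by (rule nth_equalityI) (auto simp: algebra_simps)

lemma R_multi_Nil: "R_multi D [] (x # Xs) = x"
  by (simp add: R_multi_def entry_def)

text \<open>The outermost factor takes the entries 2, ..., a + 2 in front and the last entry at the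
  end. What remains is R^E on the first entry and the \<open>mnorm E\<close> entries between them:
  factor j of R^E is factor j + 1 of the whole, with all entry numbers from 2 on shifted by a +
  1.\<close>

lemma R_multi_Cons:
  assumes "length Xs = mnorm (a # E) + 1"
  shows "R_multi D (a # E) Xs = insert_block (nabla_curv D a) a (mnorm E) (R_multi D E) Xs"
proof -
  let ?m = "mnorm E"
  obtain x ys where Xs: "Xs = x # ys" and ys: "length ys = a + ?m + 2"
    using assms by (cases Xs) auto
  define Zs where "Zs = x # take ?m (drop (a + 1) ys)"
  have entry: "entry Zs r = entry Xs (r + (a + 1))" if "2 \<le> r" "r \<le> ?m + 1" for r
  proof -
    obtain s where "r = s + 2" using le_iff_add[of 2 r] \<open>2 \<le> r\<close> by (metis add.commute)
    moreover have "(x # take ?m (drop (a + 1) ys)) ! Suc s = ys ! (a + 1 + s)"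
      using that ys \<open>r = s + 2\<close> by simp
    ultimately show ?thesis
      by (simp add: entry_def Zs_def Xs add.commute add.left_commute)
  qed
  define G where "G j V = nabla_curv D (E ! (j - 1))
      (map (entry Zs) [mnorm_upto E (j - 1) + 2..<mnorm_upto E j + 2] @ [V, entry Zs (?m - j + 2)])" for j V
  define H where "H j V = nabla_curv D ((a # E) ! (j - 1))
      (map (entry Xs) [mnorm_upto (a # E) (j - 1) + 2..<mnorm_upto (a # E) j + 2] @
        [V, entry Xs (mnorm (a # E) - j + 2)])" for j V
  have "H (Suc j) V = G j V" if j: "1 \<le> j" "j \<le> length E" for j V
  proof -
    obtain i where i: "j = Suc i" using j by (cases j) auto
    have "map (entry Zs) [mnorm_upto E i + 2..<mnorm_upto E j + 2] =
        map (\<lambda>r. entry Xs (r + (a + 1))) [mnorm_upto E i + 2..<mnorm_upto E j + 2]"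
      using mnorm_upto_le[of j E] j by (intro map_cong refl entry) auto
    also have "\<dots> = map (entry Xs) [mnorm_upto (a # E) j + 2..<mnorm_upto (a # E) (Suc j) + 2]"
      unfolding map_upt_shift i mnorm_upto_Cons by (simp add: algebra_simps)
    finally have 1: "map (entry Zs) [mnorm_upto E i + 2..<mnorm_upto E j + 2] =
        map (entry Xs) [mnorm_upto (a # E) j + 2..<mnorm_upto (a # E) (Suc j) + 2]" .
    \<comment> \<open>This keeps the truncated subtraction in \<open>?m - j + 2\<close> exact;
      closing entries are counted from the end of the list.\<close>
    have "j \<le> ?m" using j length_le_mnorm[of E] by simp
    then have "mnorm (a # E) - Suc j + 2 = (?m - j + 2) + (a + 1)" by simp
    moreover have "entry Zs (?m - j + 2) = entry Xs ((?m - j + 2) + (a + 1))"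
      using i \<open>j \<le> ?m\<close> by (intro entry) auto
    ultimately have 2: "entry Zs (?m - j + 2) = entry Xs (mnorm (a # E) - Suc j + 2)" by simp
    show ?thesis
      unfolding G_def H_def 2 using 1 i by simp
  qed
  then have "foldr (H \<circ> Suc) [1..<length E + 1] x = foldr G [1..<length E + 1] x"
    by (intro foldr_cong) (auto simp: o_def fun_eq_iff)
  moreover have "[1..<length (a # E) + 1] = 1 # map Suc [1..<length E + 1]"
    by (simp add: map_Suc_upt upt_conv_Cons del: upt_Suc)
  moreover have "R_multi D (a # E) Xs = foldr H [1..<length (a # E) + 1] x"
    unfolding R_multi_def H_def[abs_def] by (simp add: Xs entry_def)
  moreover have "R_multi D E Zs = foldr G [1..<length E + 1] x"
    unfolding R_multi_def G_def[abs_def] by (simp add: Zs_def entry_def)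
  ultimately have R: "R_multi D (a # E) Xs = H 1 (R_multi D E Zs)"
    by (simp add: foldr_map del: upt_Suc)
  have "map (entry Xs) [2..<a + 3] = take (a + 1) ys"
    by (rule nth_equalityI) (use ys in \<open>auto simp: entry_def Xs simp del: upt_Suc\<close>)
  then show ?thesis
    unfolding R H_def insert_block_def
    by (simp add: Xs Zs_def mnorm_upto_def entry_def numeral_eq_Suc del: upt_Suc)
qed

context charted
begin

lemma ml_sum_entry:
  assumes "ml m F" "Xs \<in> lists V" "length Xs = m" "i < m" "\<And>j. j \<in> J \<Longrightarrow> Z j \<in> V"
  shows "F (Xs[i := \<Sum>j\<in>J. Z j]) = (\<Sum>j\<in>J. F (Xs[i := Z j]))"
  using assms(5)
proof (induction J rule: infinite_finite_induct)
  case (insert j J)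
  have "F (Xs[i := cscale 1 (Z j) + (\<Sum>j\<in>J. Z j)]) = cscale 1 (F (Xs[i := Z j])) + F (Xs[i := \<Sum>j\<in>J. Z j])"
    using insert by (intro ml_update[OF assms(1-4)] V_closed) auto
  then show ?case using insert by simp
qed (use ml_zero_entry[OF assms(1-4)] in auto)

lemma ml_cscale_entry:
  assumes "ml m F" "Xs \<in> lists V" "length Xs = m" "i < m" "Z \<in> V"
  shows "F (Xs[i := cscale c Z]) = cscale c (F (Xs[i := Z]))"
  using ml_update[OF assms V_closed(1), of c] ml_zero_entry[OF assms(1-4)] by simp

lemma ml_insert_block:
  assumes A: "ml (a + 3) A" and B: "ml (m + 1) B"
  shows "ml (a + m + 3) (insert_block A a m B)"
proof (rule mlI)
  fix Xs assume "Xs \<in> lists V" "length Xs = a + m + 3"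
  then obtain x ys where Xs: "Xs = x # ys" "x \<in> V" "ys \<in> lists V" "length ys = a + m + 2"
    by (cases Xs) auto
  let ?P = "take (a + 1) ys" and ?Q = "take m (drop (a + 1) ys)" and ?w = "ys ! (a + 1 + m)"
  have V: "?P \<in> lists V" "?Q \<in> lists V" "?w \<in> V"
    using Xs by (intro in_lists_intros; simp)+
  have len: "length ?P = a + 1" "length ?Q = m" using Xs by auto
  have b: "B (x # ?Q) \<in> V" using V Xs len by (intro ml_value[OF B]) auto
  have L: "?P @ [B (x # ?Q), ?w] \<in> lists V" "length (?P @ [B (x # ?Q), ?w]) = a + 3"
    using V b len by auto
  show "insert_block A a m B Xs \<in> V"
    unfolding insert_block_def using ml_value[OF A L] Xs by simp
  have Bl: "A (?P @ [cscale c u + v, ?w]) = cscale c (A (?P @ [u, ?w])) + A (?P @ [v, ?w])" if "u \<in> V" "v \<in> V" for c u v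
    using ml_update[OF A L, of "a + 1" u v c] that len by (simp add: list_update_append)
  fix i c X Y assume i: "i < a + m + 3" and XY: "X \<in> V" "Y \<in> V"
  let ?I = "\<lambda>U. insert_block A a m B (Xs[i := U])"
  \<comment> \<open>The slots are the first entry, the a + 1 entries in front, the m entries passed
    on to \<open>B\<close>, and the closing entry.\<close>
  consider "i = 0" | j where "i = Suc j" "j < a + 1" | j where "i = Suc (j + (a + 1))" "j < m" | "i = a + m + 2"
  proof -
    assume *: "i = 0 \<Longrightarrow> thesis" "\<And>j. i = Suc j \<Longrightarrow> j < a + 1 \<Longrightarrow> thesis"
      "\<And>j. i = Suc (j + (a + 1)) \<Longrightarrow> j < m \<Longrightarrow> thesis" "i = a + m + 2 \<Longrightarrow> thesis"
    have "i = 0 \<or> (i = Suc (i - 1) \<and> i - 1 < a + 1) \<or>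
      (i = Suc ((i - a - 2) + (a + 1)) \<and> i - a - 2 < m) \<or> i = a + m + 2"
      using i by auto
    then show thesis using * by blast
  qed
  then show "?I (cscale c X + Y) = cscale c (?I X) + ?I Y"
  proof cases
    case 1
    have I: "?I U = A (?P @ [B (U # ?Q), ?w])" for U
      by (simp add: insert_block_def Xs 1)
    have "B ((cscale c X + Y) # ?Q) = cscale c (B (X # ?Q)) + B (Y # ?Q)"
      using ml_update[OF B, of "x # ?Q" 0 X Y c] V Xs len XY by simp
    moreover have "B (X # ?Q) \<in> V" "B (Y # ?Q) \<in> V"
      using V len XY by (auto intro!: ml_value[OF B])
    ultimately show ?thesis unfolding I using Bl by simp
  next
    case (2 j)
    have I: "?I U = A ((?P @ [B (x # ?Q), ?w])[j := U])" for U
      using 2 len by (simp add: insert_block_def Xs list_update_append take_update_swap)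
    show ?thesis unfolding I using 2 XY by (intro ml_update[OF A L]) auto
  next
    case (3 j)
    have I: "?I U = A (?P @ [B ((x # ?Q)[Suc j := U]), ?w])" for U
      using 3 len Xs by (simp add: insert_block_def take_update_swap drop_update_swap list_update_beyond)
    have "B ((x # ?Q)[Suc j := cscale c X + Y]) = cscale c (B ((x # ?Q)[Suc j := X])) + B ((x # ?Q)[Suc j := Y])"
      using V Xs len XY 3 by (intro ml_update[OF B]) auto
    moreover have "B ((x # ?Q)[Suc j := U]) \<in> V" if "U \<in> V" for U
      using V Xs len that by (intro ml_value[OF B] lists_update) auto
    ultimately show ?thesis unfolding I using XY Bl by simp
  next
    case 4
    have I: "?I U = A ((?P @ [B (x # ?Q), ?w])[a + 2 := U])" for U
      using 4 len Xs by (simp add: insert_block_def list_update_append drop_update_swap)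
    show ?thesis unfolding I using XY by (intro ml_update[OF A L]) auto
  qed
qed

end

section \<open>Values on (x, y, ..., y)\<close>

context charted
begin

text \<open>The number \<open>k\<close> counts only the repeated entry, so this concerns tensors
  with k + 1 entries; the number in \<open>diag_null\<close> counts all entries.\<close>

definition diag_eq :: "nat \<Rightarrow> 'a tensor_op \<Rightarrow> 'a tensor_op \<Rightarrow> bool" where
  "diag_eq k A B \<longleftrightarrow> (\<forall>x\<in>V. \<forall>y\<in>V. A (x # replicate k y) = B (x # replicate k y))"

definition diag_null :: "nat \<Rightarrow> 'a tensor_op \<Rightarrow> bool" where
  "diag_null m A \<longleftrightarrow> (\<forall>y\<in>V. A (replicate m y) = 0)"

lemma diag_eqD: "diag_eq k A B \<Longrightarrow> x \<in> V \<Longrightarrow> y \<in> V \<Longrightarrow> A (x # replicate k y) = B (x # replicate k y)"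
  by (simp add: diag_eq_def)

lemma diag_nullD: "diag_null m A \<Longrightarrow> y \<in> V \<Longrightarrow> A (replicate m y) = 0"
  by (simp add: diag_null_def)

lemma diag_eq_trans [trans]: "diag_eq k A B \<Longrightarrow> diag_eq k B C \<Longrightarrow> diag_eq k A C"
  by (simp add: diag_eq_def)

lemma diag_eq_null: "diag_eq k A B \<Longrightarrow> diag_null (Suc k) B \<Longrightarrow> diag_null (Suc k) A"
  by (simp add: diag_eq_def diag_null_def)

end

lemma R_multi_Cons_diag:
  "R_multi D (a # E) (x # replicate (mnorm (a # E)) y) =
    nabla_curv D a (replicate (a + 1) y @ [R_multi D E (x # replicate (mnorm E) y), y])"
proof -
  have "mnorm (a # E) = a + mnorm E + 2" by simp
  then show ?thesis
    using R_multi_Cons[of "x # replicate (mnorm (a # E)) y" a E D] insert_block_diag by (metis length_Cons length_replicate add.commute plus_1_eq_Suc)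
qed

lemma sum_lessThan_add:
  fixes f :: "nat \<Rightarrow> 'b::comm_monoid_add"
  shows "(\<Sum>i<a + m. f i) = (\<Sum>i<a. f i) + (\<Sum>i<m. f (i + a))"
  by (induction m) (simp_all add: add.assoc add.commute[of a])

definition swapped_nabla :: "('a vfield \<Rightarrow> 'a vfield \<Rightarrow> 'a vfield) \<Rightarrow> 'a tensor_op \<Rightarrow> 'a tensor_op" where
  "swapped_nabla D A = swap12 (nabla D A)"

lemma swapped_nabla_diag:
  "swapped_nabla D A (x # replicate (Suc k) y) =
    D y (A (x # replicate k y)) - A (D y x # replicate k y) - (\<Sum>i<k. A (x # (replicate k y)[i := D y y]))"
proof -
  have "(\<Sum>i<Suc k. A ((x # replicate k y)[i := D y ((x # replicate k y) ! i)])) =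
      A (D y x # replicate k y) + (\<Sum>i<k. A (x # (replicate k y)[i := D y y]))"
    by (simp add: sum.lessThan_Suc_shift del: sum.lessThan_Suc)
  then show ?thesis by (simp add: swapped_nabla_def del: sum.lessThan_Suc)
qed

context connection
begin

lemma ml_R_multi: "ml (mnorm E + 1) (R_multi D E)"
proof (induction E)
  case Nil
  show ?case
  proof (rule ml_cong)
    show "ml (mnorm [] + 1) (\<lambda>Xs. Xs ! 0)"
      by (rule mlI) (auto simp: length_Suc_conv)
    show "R_multi D [] Xs = Xs ! 0" if "length Xs = mnorm [] + 1" for Xs :: "'a vfield list"
      using that R_multi_Nil by (auto simp: length_Suc_conv)
  qed
next
  case (Cons a E)
  have "ml (a + mnorm E + 3) (insert_block (nabla_curv D a) a (mnorm E) (R_multi D E))"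
    using ml_nabla_curv Cons by (rule ml_insert_block)
  then have "ml (mnorm (a # E) + 1) (insert_block (nabla_curv D a) a (mnorm E) (R_multi D E))"
    by (simp add: numeral_eq_Suc)
  then show ?case
    by (rule ml_cong) (rule R_multi_Cons)
qed

lemma R_multi_V: "Xs \<in> lists V \<Longrightarrow> length Xs = mnorm E + 1 \<Longrightarrow> R_multi D E Xs \<in> V"
  by (rule ml_value[OF ml_R_multi])

lemma R_multi_diag_V: "x \<in> V \<Longrightarrow> y \<in> V \<Longrightarrow> R_multi D E (x # replicate (mnorm E) y) \<in> V"
  by (rule R_multi_V) auto

lemma slot_update: "(replicate (a + 1) y @ [b, w])[a + 1 := u] = replicate (a + 1) y @ [u, w]"
  by (simp add: list_update_append del: replicate_Suc)

lemma slot_in_lists: "y \<in> V \<Longrightarrow> b \<in> V \<Longrightarrow> replicate (a + 1) y @ [b, y] \<in> lists V"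
  by auto

lemma nabla_curv_slot_zero:
  assumes "y \<in> V"
  shows "nabla_curv D a (replicate (a + 1) y @ [0, y]) = 0"
proof -
  have "nabla_curv D a ((replicate (a + 1) y @ [y, y])[a + 1 := 0]) = 0"
    using assms by (intro ml_zero_entry[OF ml_nabla_curv slot_in_lists]) auto
  then show ?thesis unfolding slot_update .
qed

lemma nabla_curv_slot_sum:
  assumes "y \<in> V" "\<And>j. j \<in> J \<Longrightarrow> Z j \<in> V"
  shows "nabla_curv D a (replicate (a + 1) y @ [\<Sum>j\<in>J. Z j, y]) =
    (\<Sum>j\<in>J. nabla_curv D a (replicate (a + 1) y @ [Z j, y]))"
proof -
  have "nabla_curv D a ((replicate (a + 1) y @ [y, y])[a + 1 := \<Sum>j\<in>J. Z j]) =
      (\<Sum>j\<in>J. nabla_curv D a ((replicate (a + 1) y @ [y, y])[a + 1 := Z j]))"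
    using assms by (intro ml_sum_entry[OF ml_nabla_curv slot_in_lists]) auto
  then show ?thesis unfolding slot_update .
qed

text \<open>The innermost factor is evaluated on (y, ..., y), where \<open>nabla_curv\<close>
  vanishes, and the outer factors send 0 to 0. The empty list is excluded because its operator is
  the identity.\<close>

lemma R_multi_diag_null: "E \<noteq> [] \<Longrightarrow> diag_null (mnorm E + 1) (R_multi D E)"
proof (induction E)
  case (Cons a E)
  show ?case
    unfolding diag_null_def
  proof
    fix y assume y: "y \<in> V"
    have eq: "R_multi D (a # E) (replicate (mnorm (a # E) + 1) y) =
        nabla_curv D a (replicate (a + 1) y @ [R_multi D E (y # replicate (mnorm E) y), y])"
      using R_multi_Cons_diag[of D a E y y] by simp
    show "R_multi D (a # E) (replicate (mnorm (a # E) + 1) y) = 0"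
    proof (cases "E = []")
      case True
      have "replicate (a + 1) y @ [y, y] = replicate (a + 3) y"
        by (simp add: numeral_eq_Suc flip: replicate_append_same)
      then show ?thesis
        unfolding eq using nabla_curv_diag_zero[OF y] by (simp add: True R_multi_Nil)
    next
      case False
      then have "R_multi D E (y # replicate (mnorm E) y) = 0"
        using diag_nullD[OF Cons.IH y] by simp
      then show ?thesis
        unfolding eq using nabla_curv_slot_zero[OF y] by simp
    qed
  qed
qed simp

text \<open>The entries used by the outer factors enclose those of the inner ones; once all of them
  are y, this nesting is invisible and concatenation becomes composition.\<close>

lemma R_multi_append_diag:
  assumes "x \<in> V" "y \<in> V"
  shows "R_multi D (E @ F) (x # replicate (mnorm (E @ F)) y) =
    R_multi D E (R_multi D F (x # replicate (mnorm F) y) # replicate (mnorm E) y)"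
proof (induction E)
  case (Cons a E)
  then show ?case
    by (simp only: append_Cons R_multi_Cons_diag)
qed (simp add: R_multi_Nil)

text \<open>The terms with D_y y in a slot enter only through their sum, a linearization of y
  \<mapsto> A(x, y, ..., y), so \<open>diag_eq\<close> is enough to transfer the derivative.\<close>

lemma swapped_nabla_cong:
  assumes "ml (Suc k) A" "ml (Suc k) B" "diag_eq k A B"
  shows "diag_eq (Suc k) (swapped_nabla D A) (swapped_nabla D B)"
  unfolding diag_eq_def
proof (intro ballI)
  fix x y assume V: "x \<in> V" "y \<in> V"
  have "(\<Sum>i<k. A (x # (replicate k y)[i := D y y])) = (\<Sum>i<k. B (x # (replicate k y)[i := D y y]))"
    using assms V by (intro ml_linearize_cong[OF ml_Cons ml_Cons]) (auto intro: D_V simp: diag_eq_def)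
  then show "swapped_nabla D A (x # replicate (Suc k) y) = swapped_nabla D B (x # replicate (Suc k) y)"
    unfolding swapped_nabla_diag using assms(3) V D_V by (simp add: diag_eq_def)
qed

text \<open>Leibniz rule for a composition. With b = B(x, y, ..., y), the derivative of A subtracts
  A(..., D_y b, y), which the derivative of B in that slot restores; the corrections by D_y y match
  slot by slot.\<close>

lemma swapped_nabla_insert_block:
  assumes A: "ml (a + 3) A" and B: "ml (m + 1) B" and V: "x \<in> V" "y \<in> V"
  shows "swapped_nabla D (insert_block A a m B) (x # replicate (a + m + 3) y) =
    nabla D A (replicate (a + 2) y @ [B (x # replicate m y), y]) +
    A (replicate (a + 1) y @ [swapped_nabla D B (x # replicate (Suc m) y), y])"
proof -
  let ?C = "insert_block A a m B" and ?b = "B (x # replicate m y)" and ?z = "D y y" and ?P = "replicate (a + 1) y"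
  have z: "?z \<in> V" using V D_V by simp
  have BV: "B (u # us) \<in> V" if "u \<in> V" "us \<in> lists V" "length us = m" for u us
    using that by (intro ml_value[OF B]) auto
  have b: "?b \<in> V" using V by (intro BV) auto
  let ?f = "\<lambda>i. ?C (x # (replicate (a + m + 2) y)[i := ?z])"
  \<comment> \<open>The slot that receives D_y y lies in the block in front, among the entries of
    \<open>B\<close>, or at the end.\<close>
  have f1: "?f i = A (?P[i := ?z] @ [?b, y])" if "i < a + 1" for i
    using that by (simp add: insert_block_def take_update_swap min_def del: replicate_Suc)
  have f2: "?f (i + (a + 1)) = A (?P @ [B (x # (replicate m y)[i := ?z]), y])" if "i < m" for i
    using that by (simp add: insert_block_def take_update_swap drop_update_swap list_update_beyond min_def del: replicate_Suc)
  have f3: "?f (a + 1 + m) = A (?P @ [?b, ?z])"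
    by (simp add: insert_block_def take_update_swap drop_update_swap list_update_beyond min_def del: replicate_Suc)
  have "(\<Sum>i<a + m + 2. ?f i) = (\<Sum>i<a + 1. ?f i) + (\<Sum>i<m. ?f (i + (a + 1))) + ?f (a + 1 + m)"
  proof -
    have "(\<Sum>i<a + m + 2. ?f i) = (\<Sum>i<a + 1 + m. ?f i) + ?f (a + 1 + m)"
      by (simp add: add.commute add.left_commute)
    also have "(\<Sum>i<a + 1 + m. ?f i) = (\<Sum>i<a + 1. ?f i) + (\<Sum>i<m. ?f (i + (a + 1)))"
      by (rule sum_lessThan_add)
    finally show ?thesis .
  qed
  then have sumC: "(\<Sum>i<a + m + 2. ?f i) = (\<Sum>i<a + 1. A (?P[i := ?z] @ [?b, y])) +
      (\<Sum>i<m. A (?P @ [B (x # (replicate m y)[i := ?z]), y])) + A (?P @ [?b, ?z])"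
    using f1 f2 f3 by simp
  let ?L = "?P @ [?b, y]"
  have L: "?L \<in> lists V" "length ?L = a + 3" "a + 1 < a + 3" using b V by auto
  let ?g = "\<lambda>i. A (?L[i := D y (?L ! i)])"
  have g1: "?g i = A (?P[i := ?z] @ [?b, y])" if "i < a + 1" for i
    using that by (simp add: list_update_append nth_append del: replicate_Suc)
  have "(\<Sum>i<a + 3. ?g i) = (\<Sum>i<a + 1. ?g i) + ?g (a + 1) + ?g (a + 2)"
    by (simp add: numeral_eq_Suc)
  also have "?g (a + 1) = A (?P @ [D y ?b, y])"
    by (simp add: list_update_append nth_append del: replicate_Suc)
  also have "?g (a + 2) = A (?P @ [?b, ?z])"
    by (simp add: list_update_append nth_append del: replicate_Suc)
  finally have sumA: "(\<Sum>i<a + 3. ?g i) =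
      (\<Sum>i<a + 1. A (?P[i := ?z] @ [?b, y])) + A (?P @ [D y ?b, y]) + A (?P @ [?b, ?z])"
    using g1 by simp
  have "replicate (a + 2) y @ [?b, y] = y # ?L" by simp
  then have nabA: "nabla D A (replicate (a + 2) y @ [?b, y]) = D y (A ?L) - (\<Sum>i<a + 3. ?g i)"
    using L(2) by (simp only: nabla.simps)
  have AN: "A (?P @ [swapped_nabla D B (x # replicate (Suc m) y), y]) = A (?P @ [D y ?b, y]) -
      A (?P @ [B (D y x # replicate m y), y]) - (\<Sum>i<m. A (?P @ [B (x # (replicate m y)[i := ?z]), y]))"
  proof -
    have diff: "A (?P @ [u - v, y]) = A (?P @ [u, y]) - A (?P @ [v, y])" if "u \<in> V" "v \<in> V" for u v
      using ml_update[OF A L, of v u "- 1"] that unfolding slot_update by simp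
    have s: "A (?P @ [\<Sum>i<m. B (x # (replicate m y)[i := ?z]), y]) =
        (\<Sum>i<m. A (?P @ [B (x # (replicate m y)[i := ?z]), y]))"
    proof -
      have "A (?L[a + 1 := \<Sum>i<m. B (x # (replicate m y)[i := ?z])]) =
          (\<Sum>i<m. A (?L[a + 1 := B (x # (replicate m y)[i := ?z])]))"
        using V z by (intro ml_sum_entry[OF A L] BV lists_update) auto
      then show ?thesis unfolding slot_update .
    qed
    have Bz: "B (x # (replicate m y)[i := ?z]) \<in> V" for i
      using V z by (intro BV lists_update) auto
    have 1: "D y ?b \<in> V" "B (D y x # replicate m y) \<in> V" "(\<Sum>i<m. B (x # (replicate m y)[i := ?z])) \<in> V"
      using V b by (auto intro!: D_V BV V_closed Bz)
    show ?thesis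
      unfolding swapped_nabla_diag using diff[OF V_closed(4)[OF 1(1,2)] 1(3)] diff[OF 1(1,2)] s by simp
  qed
  have "swapped_nabla D ?C (x # replicate (a + m + 3) y) = D y (?C (x # replicate (a + m + 2) y)) -
      ?C (D y x # replicate (a + m + 2) y) - (\<Sum>i<a + m + 2. ?f i)"
    using swapped_nabla_diag[of D ?C x "a + m + 2" y] by (simp add: numeral_eq_Suc)
  then show ?thesis
    unfolding insert_block_diag sumC nabA AN sumA by (simp add: algebra_simps)
qed

text \<open>By the Leibniz rule, differentiating the outermost factor raises the first entry, and
  the induction hypothesis, inserted by linearity, raises the others.\<close>

lemma swapped_nabla_R_multi:
  assumes "x \<in> V" "y \<in> V"
  shows "swapped_nabla D (R_multi D E) (x # replicate (Suc (mnorm E)) y) =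
    (\<Sum>j<length E. R_multi D (E[j := Suc (E ! j)]) (x # replicate (Suc (mnorm E)) y))"
proof (induction E)
  case Nil
  then show ?case using swapped_nabla_diag[of D "R_multi D []" x 0 y] by (simp add: R_multi_Nil)
next
  case (Cons a E)
  let ?m = "mnorm E" and ?n = "mnorm (a # E)"
  let ?C = "insert_block (nabla_curv D a) a ?m (R_multi D E)"
  have n: "Suc ?n = a + ?m + 3" by simp
  have C: "ml (Suc ?n) ?C"
    unfolding n by (rule ml_insert_block[OF ml_nabla_curv ml_R_multi])
  have R: "ml (Suc ?n) (R_multi D (a # E))"
    using ml_R_multi[of "a # E"] by simp
  \<comment> \<open>The two operators agree on lists of the right length but need not be equal as
    functions, so the derivative is transferred by \<open>swapped_nabla_cong\<close>.\<close>
  have "diag_eq ?n (R_multi D (a # E)) ?C"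
    by (simp add: diag_eq_def R_multi_Cons)
  then have "swapped_nabla D (R_multi D (a # E)) (x # replicate (Suc ?n) y) = swapped_nabla D ?C (x # replicate (Suc ?n) y)"
    using swapped_nabla_cong[OF R C] assms diag_eqD by blast
  also have "\<dots> = nabla_curv D (Suc a) (replicate (a + 2) y @ [R_multi D E (x # replicate ?m y), y]) +
      nabla_curv D a (replicate (a + 1) y @ [swapped_nabla D (R_multi D E) (x # replicate (Suc ?m) y), y])"
    unfolding n nabla_curv_Suc by (rule swapped_nabla_insert_block[OF ml_nabla_curv ml_R_multi assms])
  also have "nabla_curv D (Suc a) (replicate (a + 2) y @ [R_multi D E (x # replicate ?m y), y]) =
      R_multi D (Suc a # E) (x # replicate (Suc ?n) y)"
    using R_multi_Cons_diag[of D "Suc a" E x y] by simp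
  also have "nabla_curv D a (replicate (a + 1) y @ [swapped_nabla D (R_multi D E) (x # replicate (Suc ?m) y), y]) =
      (\<Sum>j<length E. R_multi D (a # E[j := Suc (E ! j)]) (x # replicate (Suc ?n) y))"
  proof -
    have "nabla_curv D a (replicate (a + 1) y @ [R_multi D (E[j := Suc (E ! j)]) (x # replicate (Suc ?m) y), y]) =
        R_multi D (a # E[j := Suc (E ! j)]) (x # replicate (Suc ?n) y)" if "j < length E" for j
      using R_multi_Cons_diag[of D a "E[j := Suc (E ! j)]" x y] mnorm_update_Suc[OF that] by simp
    moreover have "R_multi D (E[j := Suc (E ! j)]) (x # replicate (Suc ?m) y) \<in> V" if "j < length E" for j
      using R_multi_diag_V[OF assms, of "E[j := Suc (E ! j)]"] mnorm_update_Suc[OF that] by simp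
    ultimately show ?thesis
      unfolding Cons.IH by (subst nabla_curv_slot_sum) (use assms in auto)
  qed
  finally show ?case
    by (simp add: sum.lessThan_Suc_shift del: sum.lessThan_Suc replicate_Suc)
qed

end

section \<open>The recursion\<close>

text \<open>The first term of \<open>wedge1\<close>; the second is this one with the first two
  entries exchanged, so that multilinearity is checked once.\<close>

fun half_wedge :: "nat \<Rightarrow> 'a tensor_op \<Rightarrow> 'a tensor_op \<Rightarrow> 'a tensor_op" where
  "half_wedge l A B (X # Y # Zs) = A (X # B (Y # take l Zs) # drop l Zs)"

lemma sum_apply: "(\<Sum>i\<in>I. f i) x = (\<Sum>i\<in>I. f i x)"
  by (induction I rule: infinite_finite_induct) (auto simp: plus_fun_apply zero_fun_apply)

context charted
begin

lemma ml_swap12: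
  assumes A: "ml (Suc (Suc m)) A"
  shows "ml (Suc (Suc m)) (swap12 A)"
proof (rule mlI)
  fix Xs assume "Xs \<in> lists V" "length Xs = Suc (Suc m)"
  then obtain X Y Zs where Xs: "Xs = X # Y # Zs" "X \<in> V" "Y \<in> V" "Zs \<in> lists V" "length Zs = m"
    by (auto simp: length_Suc_conv in_lists_conv_set)
  then show "swap12 A Xs \<in> V" using ml_value[OF A, of "Y # X # Zs"] by simp
  fix i c S T assume i: "i < Suc (Suc m)" and "S \<in> V" "T \<in> V"
  define j where "j = (if i = 0 then 1 else if i = 1 then 0 else i)"
  have "swap12 A (Xs[i := U]) = A ((Y # X # Zs)[j := U])" for U
    by (auto simp: Xs j_def split: nat.split)
  moreover have "j < Suc (Suc m)" using i by (auto simp: j_def)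
  ultimately show "swap12 A (Xs[i := cscale c S + T]) = cscale c (swap12 A (Xs[i := S])) + swap12 A (Xs[i := T])"
    using ml_update[OF A, of "Y # X # Zs" j S T c] Xs \<open>S \<in> V\<close> \<open>T \<in> V\<close> by simp
qed

lemma ml_half_wedge:
  assumes A: "ml (p + 2) A" and B: "ml (q + 1) B"
  shows "ml (p + q + 2) (half_wedge q A B)"
proof (rule mlI)
  fix Xs assume "Xs \<in> lists V" "length Xs = p + q + 2"
  then obtain X Y Zs where Xs: "Xs = X # Y # Zs" "X \<in> V" "Y \<in> V" "Zs \<in> lists V" "length Zs = p + q"
    by (auto simp: length_Suc_conv in_lists_conv_set)
  let ?Q = "take q Zs" and ?R = "drop q Zs"
  have V: "?Q \<in> lists V" "?R \<in> lists V" by (intro take_in_lists drop_in_lists Xs)+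
  have len: "length ?Q = q" "length ?R = p" using Xs by auto
  have b: "B (Y # ?Q) \<in> V" using V Xs len by (intro ml_value[OF B]) auto
  let ?L = "X # B (Y # ?Q) # ?R"
  have L: "?L \<in> lists V" "length ?L = p + 2" using V b len Xs by auto
  show "half_wedge q A B Xs \<in> V" using ml_value[OF A L] Xs by simp
  fix i c S T assume i: "i < p + q + 2" and ST: "S \<in> V" "T \<in> V"
  let ?I = "\<lambda>U. half_wedge q A B (Xs[i := U])"
  have slot: "?I (cscale c S + T) = cscale c (?I S) + ?I T"
    if I: "\<And>U. ?I U = A (X # B ((Y # ?Q)[j := U]) # ?R)" and j: "j < q + 1" for j
  proof -
    have YQ: "Y # ?Q \<in> lists V" "length (Y # ?Q) = q + 1" using V Xs len by auto
    have "B ((Y # ?Q)[j := U]) \<in> V" if "U \<in> V" for U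
      using YQ that by (intro ml_value[OF B] lists_update) (simp_all only: length_list_update)
    then have "A (?L[1 := cscale c (B ((Y # ?Q)[j := S])) + B ((Y # ?Q)[j := T])]) =
        cscale c (A (?L[1 := B ((Y # ?Q)[j := S])])) + A (?L[1 := B ((Y # ?Q)[j := T])])"
      using ST by (intro ml_update[OF A L]) auto
    moreover have "B ((Y # ?Q)[j := cscale c S + T]) = cscale c (B ((Y # ?Q)[j := S])) + B ((Y # ?Q)[j := T])"
      by (rule ml_update[OF B YQ j ST])
    ultimately show ?thesis unfolding I by simp
  qed
  consider "i = 0" | "i = 1" | j where "i = Suc (Suc j)" "j < q" | j where "i = Suc (Suc (j + q))" "j < p"
  proof -
    assume *: "i = 0 \<Longrightarrow> thesis" "i = 1 \<Longrightarrow> thesis" "\<And>j. i = Suc (Suc j) \<Longrightarrow> j < q \<Longrightarrow> thesis"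
      "\<And>j. i = Suc (Suc (j + q)) \<Longrightarrow> j < p \<Longrightarrow> thesis"
    have "i = 0 \<or> i = 1 \<or> (i = Suc (Suc (i - 2)) \<and> i - 2 < q) \<or>
      (i = Suc (Suc ((i - 2 - q) + q)) \<and> i - 2 - q < p)"
      using i by auto
    then show thesis using * by blast
  qed
  then show "?I (cscale c S + T) = cscale c (?I S) + ?I T"
  proof cases
    case 1
    have I: "?I U = A (?L[0 := U])" for U by (simp add: Xs 1)
    show ?thesis unfolding I by (rule ml_update[OF A L _ ST]) simp
  next
    case 2
    show ?thesis by (rule slot[of 0]) (simp_all add: Xs 2)
  next
    case (3 j)
    show ?thesis by (rule slot[of "Suc j"]) (simp_all add: Xs 3 take_update_swap)
  next
    case (4 j)
    have I: "?I U = A (?L[Suc (Suc j) := U])" for U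
      by (simp add: Xs 4 drop_update_swap)
    show ?thesis unfolding I by (rule ml_update[OF A L _ ST]) (use 4 in simp)
  qed
qed

lemma ml_wedge1:
  assumes "ml (p + 1) A" "ml (q + 1) B" "p \<ge> 1"
  shows "ml (p + q + 1) (wedge1 q A B)"
proof -
  obtain p' where p: "p = Suc p'" using assms(3) by (cases p) auto
  have W: "ml (Suc (Suc (p' + q))) (half_wedge q A B)"
    using ml_half_wedge[of p' A q B] assms p by simp
  have "ml (Suc (Suc (p' + q))) (\<lambda>Xs. half_wedge q A B Xs - swap12 (half_wedge q A B) Xs)"
    by (intro ml_diff ml_swap12 W)
  then have "ml (Suc (Suc (p' + q))) (wedge1 q A B)"
    by (rule ml_cong) (auto simp: length_Suc_conv)
  then show ?thesis by (simp add: p)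
qed

lemma ml_tscale: "ml m A \<Longrightarrow> ml m (tscale c A)"
  unfolding tscale_def by (rule ml_cscale)

lemma wedge1_diag_null: "diag_null (Suc (Suc m)) (wedge1 q A B)"
  by (simp add: diag_null_def)

definition symmetric_tail :: "nat \<Rightarrow> 'a tensor_op \<Rightarrow> bool" where
  "symmetric_tail k A \<longleftrightarrow> (\<forall>X\<in>V. \<forall>Ys\<in>lists V. \<forall>Zs. length Ys = k \<longrightarrow> mset Ys = mset Zs \<longrightarrow> A (X # Ys) = A (X # Zs))"

text \<open>Linearizing \<open>A(y, \<dots>, y) = 0\<close> in the direction \<open>z\<close>: this is where the factor \<open>p\<close> in \<open>p S\<^sub>p \<and>\<^sub>1 S\<^sub>q\<close> is absorbed.\<close>

lemma symmetric_tail_slot: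
  assumes A: "ml (p + 1) A" "symmetric_tail p A" "diag_null (p + 1) A" and V: "y \<in> V" "z \<in> V" and p: "p \<ge> 1"
  shows "cscale (of_nat p) (A (y # z # replicate (p - 1) y)) = - A (z # replicate p y)"
proof -
  have "0 = (\<Sum>i<p + 1. A ((replicate (p + 1) y)[i := z]))"
    using A V by (intro ml_linearize[symmetric]) (auto simp: diag_null_def)
  also have "\<dots> = A (z # replicate p y) + (\<Sum>i<p. A (y # (replicate p y)[i := z]))"
    by (simp add: sum.lessThan_Suc_shift del: sum.lessThan_Suc)
  also have "(\<Sum>i<p. A (y # (replicate p y)[i := z])) = (\<Sum>i<p. A (y # z # replicate (p - 1) y))"
  proof (rule sum.cong[OF refl])
    fix i assume "i \<in> {..<p}"
    then have "mset ((replicate p y)[i := z]) = mset (z # replicate (p - 1) y)"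
      by (intro mset_update_replicate) simp
    moreover have "(replicate p y)[i := z] \<in> lists V"
      using V by (intro in_lists_intros)
    ultimately show "A (y # (replicate p y)[i := z]) = A (y # z # replicate (p - 1) y)"
      using A(2) V unfolding symmetric_tail_def by simp
  qed
  also have "\<dots> = cscale (of_nat p) (A (y # z # replicate (p - 1) y))"
    by (simp only: vfield.sum_constant_scale card_lessThan)
  finally show ?thesis by (simp add: eq_neg_iff_add_eq_0 add.commute)
qed

text \<open>The first term contains B(y, ..., y) = 0. The second is -p A(y, B(x, y, ..., y), y, ...,
  y), and \<open>symmetric_tail_slot\<close> moves the inner value to the front, using up both the
  sign and the factor p.\<close>

lemma wedge1_diag:
  assumes A: "ml (p + 1) A" "symmetric_tail p A" "diag_null (p + 1) A" and p: "p \<ge> 1"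
    and B: "ml (q + 1) B" "diag_null (q + 1) B" and V: "x \<in> V" "y \<in> V"
  shows "wedge1 q (tscale (of_nat p) A) B (x # replicate (p + q) y) = A (B (x # replicate q y) # replicate p y)"
proof -
  obtain p' where p': "p = Suc p'" using p by (cases p) auto
  have b: "B (x # replicate q y) \<in> V" using V by (intro ml_value[OF B(1)]) auto
  have "A (x # 0 # replicate p' y) = 0"
    using ml_zero_entry[OF A(1), of "x # replicate p y" 1] V by (simp add: p' in_lists_conv_set)
  moreover have "B (y # replicate q y) = 0"
    using diag_nullD[OF B(2) V(2)] by simp
  moreover have "replicate (p + q) y = y # replicate (p' + q) y" by (simp add: p')
  ultimately have "wedge1 q (tscale (of_nat p) A) B (x # replicate (p + q) y) =
      - cscale (of_nat p) (A (y # B (x # replicate q y) # replicate p' y))"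
    by (simp add: tscale_def min_def)
  also have "\<dots> = A (B (x # replicate q y) # replicate p y)"
    using symmetric_tail_slot[OF A V(2) b p] by (simp add: p')
  finally show ?thesis .
qed

end

context connection
begin

lemma ml_d1:
  assumes "ml (Suc m) A"
  shows "ml (Suc (Suc m)) (d1 D A)"
proof -
  have "ml (Suc (Suc m)) (\<lambda>Xs. nabla D A Xs - swap12 (nabla D A) Xs)"
    using assms by (intro ml_diff ml_swap12 ml_nabla)
  then show ?thesis
    by (rule ml_cong) (auto simp: length_Suc_conv simp del: nabla.simps)
qed

lemma ml_id1: "ml (Suc m) A \<Longrightarrow> ml (Suc (Suc m)) (id1 D A)"
  unfolding id1_def by (intro ml_tscale ml_d1)

lemma ml_id1_pow: "ml (Suc m) A \<Longrightarrow> ml (Suc (m + j)) ((id1 D ^^ j) A)"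
  by (induction j) (auto intro: ml_id1)

text \<open>The half of d_1 that differentiates along x acts on (y, ..., y) and vanishes by
  \<open>nabla_diag_zero\<close>; antisymmetry in the first two entries makes the result vanish on
  (y, ..., y) again.\<close>

lemma id1_diag:
  assumes "ml (Suc k) A" "diag_null (Suc k) A"
  shows "diag_eq (Suc k) (id1 D A) (\<lambda>Xs. cscale (- \<i>) (swapped_nabla D A Xs))" "diag_null (Suc (Suc k)) (id1 D A)"
proof -
  have "nabla D A (x # replicate (Suc k) y) = 0" if "x \<in> V" "y \<in> V" for x y
    using nabla_diag_zero[OF assms(1) _ that] assms(2) unfolding diag_null_def by blast
  then show "diag_eq (Suc k) (id1 D A) (\<lambda>Xs. cscale (- \<i>) (swapped_nabla D A Xs))"
    by (simp add: diag_eq_def id1_def tscale_def swapped_nabla_def del: nabla.simps)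
  show "diag_null (Suc (Suc k)) (id1 D A)"
    by (simp add: diag_null_def id1_def tscale_def del: nabla.simps)
qed

section \<open>Operations on coefficients of combinations of the R^E\<close>

definition R_comb :: "(nat list \<Rightarrow> complex) \<Rightarrow> nat \<Rightarrow> 'a tensor_op" where
  "R_comb c k Xs = (\<Sum>E | mnorm E = k. cscale (c E) (R_multi D E Xs))"

lemma ml_R_comb: "ml (Suc k) (R_comb c k)"
proof -
  have "ml (Suc k) (\<lambda>Xs. \<Sum>E | mnorm E = k. cscale (c E) (R_multi D E Xs))"
  proof (intro ml_sum ml_cscale)
    fix E assume "E \<in> {E. mnorm E = k}"
    then show "ml (Suc k) (R_multi D E)" using ml_R_multi[of E] by simp
  qed
  then show ?thesis unfolding R_comb_def[abs_def] .
qed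

lemma R_comb_diag_null:
  assumes "k \<ge> 1"
  shows "diag_null (Suc k) (R_comb c k)"
proof -
  have "R_multi D E (replicate (Suc k) y) = 0" if "mnorm E = k" "y \<in> V" for E y
  proof -
    have "E \<noteq> []" using assms that by auto
    from diag_nullD[OF R_multi_diag_null[OF this]] that show ?thesis by simp
  qed
  then show ?thesis
    unfolding diag_null_def R_comb_def by (intro ballI sum.neutral) (simp del: replicate_Suc)
qed

lemma swapped_nabla_lincomb:
  assumes F: "\<And>i. i \<in> I \<Longrightarrow> ml (Suc k) (F i)" and V: "x \<in> V" "y \<in> V"
  shows "swapped_nabla D (\<lambda>Xs. \<Sum>i\<in>I. cscale (c i) (F i Xs)) (x # replicate (Suc k) y) =
    (\<Sum>i\<in>I. cscale (c i) (swapped_nabla D (F i) (x # replicate (Suc k) y)))"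
proof -
  have FV: "F i (x # replicate k y) \<in> V" if "i \<in> I" for i
    using V by (intro ml_value[OF F[OF that]]) auto
  have "D y (\<Sum>i\<in>I. cscale (c i) (F i (x # replicate k y))) = (\<Sum>i\<in>I. cscale (c i) (D y (F i (x # replicate k y))))"
    using V FV by (simp add: D_sum_right D_cscale_right V_closed)
  then show ?thesis
    unfolding swapped_nabla_diag
    by (simp add: vfield.scale_right_diff_distrib sum_subtractf vfield.scale_sum_right)
       (rule sum.swap)
qed

lemma swapped_nabla_R_comb: "diag_eq (Suc k) (swapped_nabla D (R_comb c k)) (R_comb (del c) (Suc k))"
  unfolding diag_eq_def
proof (intro ballI)
  fix x y assume V: "x \<in> V" "y \<in> V"
  let ?R = "\<lambda>E. R_multi D E (x # replicate (Suc k) y)"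
  have ml: "ml (Suc k) (R_multi D E)" if "E \<in> {E. mnorm E = k}" for E
    using ml_R_multi[of E] that by simp
  have "swapped_nabla D (R_comb c k) (x # replicate (Suc k) y) =
      (\<Sum>E | mnorm E = k. cscale (c E) (swapped_nabla D (R_multi D E) (x # replicate (Suc k) y)))"
    unfolding R_comb_def[abs_def] by (rule swapped_nabla_lincomb[OF ml V])
  also have "\<dots> = (\<Sum>E | mnorm E = k. \<Sum>j<length E. cscale (c E) (?R (E[j := Suc (E ! j)])))"
  proof (rule sum.cong[OF refl])
    fix E assume "E \<in> {E. mnorm E = k}"
    then show "cscale (c E) (swapped_nabla D (R_multi D E) (x # replicate (Suc k) y)) =
        (\<Sum>j<length E. cscale (c E) (?R (E[j := Suc (E ! j)])))"
      using swapped_nabla_R_multi[OF V, of E] by (simp add: vfield.scale_sum_right del: replicate_Suc)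
  qed
  also have "\<dots> = (\<Sum>(E, j)\<in>(SIGMA E:{E. mnorm E = k}. {..<length E}). cscale (c E) (?R (E[j := Suc (E ! j)])))"
    by (rule sum.Sigma) (auto simp: finite_mnorm)
  \<comment> \<open>Pairs (E, j) correspond to pairs (G, j) with G_j > 0, where G is E with entry j
    raised by one; collecting by G produces \<open>del c\<close>.\<close>
  also have "\<dots> = (\<Sum>(G, j)\<in>(SIGMA G:{G. mnorm G = Suc k}. {j. j < length G \<and> G ! j \<noteq> 0}).
      cscale (c (G[j := G ! j - 1])) (?R G))"
    by (rule sum.reindex_bij_witness[where i = "\<lambda>(G, j). (G[j := G ! j - 1], j)" and
          j = "\<lambda>(E, j). (E[j := Suc (E ! j)], j)"])
      (auto simp: mnorm_update_Suc mnorm_update_pred'[simplified] simp del: replicate_Suc)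
  also have "\<dots> = (\<Sum>G | mnorm G = Suc k. \<Sum>j | j < length G \<and> G ! j \<noteq> 0. cscale (c (G[j := G ! j - 1])) (?R G))"
    by (rule sum.Sigma[symmetric]) (auto simp: finite_mnorm)
  also have "\<dots> = (\<Sum>G | mnorm G = Suc k. cscale (del c G) (?R G))"
  proof (rule sum.cong[OF refl])
    fix G
    have "(\<Sum>j | j < length G \<and> G ! j \<noteq> 0. cscale (c (G[j := G ! j - 1])) (?R G)) =
        cscale (\<Sum>j | j < length G \<and> G ! j \<noteq> 0. c (G[j := G ! j - 1])) (?R G)"
      by (simp add: vfield.scale_sum_left)
    also have "(\<Sum>j | j < length G \<and> G ! j \<noteq> 0. c (G[j := G ! j - 1])) = del c G"
      unfolding del_eq_sum by (rule sum.mono_neutral_cong_left) auto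
    finally show "(\<Sum>j | j < length G \<and> G ! j \<noteq> 0. cscale (c (G[j := G ! j - 1])) (?R G)) = cscale (del c G) (?R G)" .
  qed
  finally show "swapped_nabla D (R_comb c k) (x # replicate (Suc k) y) = R_comb (del c) (Suc k) (x # replicate (Suc k) y)"
    by (simp only: R_comb_def)
qed

text \<open>The invariant carried through all operations: multilinearity and vanishing on (y, ...,
  y) accompany the coefficients because the linearizations behind \<open>id1\<close> and
  \<open>wedge1\<close> rely on them. Uniqueness of \<open>c\<close> is not claimed.\<close>

definition represents :: "nat \<Rightarrow> (nat list \<Rightarrow> complex) \<Rightarrow> 'a tensor_op \<Rightarrow> bool" where
  "represents k c A \<longleftrightarrow> ml (Suc k) A \<and> diag_null (Suc k) A \<and> diag_eq k A (R_comb c k)"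

lemma R_comb_scale: "R_comb (\<lambda>E. a * c E) k Xs = cscale a (R_comb c k Xs)"
  by (simp add: R_comb_def vfield.scale_sum_right)

lemma R_comb_add: "R_comb (\<lambda>E. c E + d E) k Xs = R_comb c k Xs + R_comb d k Xs"
  by (simp add: R_comb_def vfield.scale_left_distrib sum.distrib)

lemma R_comb_graded_part: "R_comb (graded_part k c) k = R_comb c k"
  by (simp add: fun_eq_iff R_comb_def graded_part_def)

lemma represents_tscale: "represents k c A \<Longrightarrow> represents k (\<lambda>E. a * c E) (tscale a A)"
  by (simp add: represents_def ml_tscale diag_null_def diag_eq_def R_comb_scale) (simp add: tscale_def)

lemma represents_add: "represents k c A \<Longrightarrow> represents k d B \<Longrightarrow> represents k (\<lambda>E. c E + d E) (A + B)"
  using ml_add[of "Suc k" A B]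
  by (simp add: represents_def diag_null_def diag_eq_def R_comb_add plus_fun_def[of A B])

lemma represents_zero: "represents k (\<lambda>E. 0) 0"
  using ml_zero[of "Suc k"]
  by (simp add: represents_def diag_null_def diag_eq_def R_comb_def zero_fun_def[where 'a = "'a vfield list"])

lemma represents_sum:
  "(\<And>i. i \<in> I \<Longrightarrow> represents k (c i) (A i)) \<Longrightarrow> represents k (\<lambda>E. \<Sum>i\<in>I. c i E) (\<Sum>i\<in>I. A i)"
  by (induction I rule: infinite_finite_induct) (auto intro: represents_zero represents_add)

lemma represents_swapped_nabla:
  assumes "represents k c A"
  shows "diag_eq (Suc k) (swapped_nabla D A) (R_comb (del c) (Suc k))"
  using swapped_nabla_cong[OF _ ml_R_comb] swapped_nabla_R_comb diag_eq_trans assms unfolding represents_def by blast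

lemma represents_id1:
  assumes "represents k c A"
  shows "represents (Suc k) (delta c) (id1 D A)"
proof -
  have A: "ml (Suc k) A" "diag_null (Suc k) A" using assms by (auto simp: represents_def)
  have "diag_eq (Suc k) (id1 D A) (R_comb (delta c) (Suc k))"
    using id1_diag(1)[OF A] represents_swapped_nabla[OF assms]
    unfolding diag_eq_def delta_def R_comb_scale by simp
  then show ?thesis
    unfolding represents_def using ml_id1[OF A(1)] id1_diag(2)[OF A] by blast
qed

lemma represents_id1_pow: "represents k c A \<Longrightarrow> represents (k + j) ((delta ^^ j) c) ((id1 D ^^ j) A)"
  by (induction j) (auto intro: represents_id1)

lemma R_comb_conv:
  assumes V: "x \<in> V" "y \<in> V"
  shows "R_comb f p (R_comb g q (x # replicate q y) # replicate p y) =
    R_comb (conv (graded_part p f) (graded_part q g)) (p + q) (x # replicate (p + q) y)"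
proof -
  let ?R = "\<lambda>G. R_multi D G (x # replicate (p + q) y)"
  have "R_multi D E (R_comb g q (x # replicate q y) # replicate p y) =
      (\<Sum>F | mnorm F = q. cscale (g F) (?R (E @ F)))" if E: "mnorm E = p" for E
  proof -
    have RV: "R_multi D F (x # replicate q y) \<in> V" if "mnorm F = q" for F
      using R_multi_diag_V[OF V, of F] that by simp
    have E': "ml (p + 1) (R_multi D E)" "x # replicate p y \<in> lists V" "length (x # replicate p y) = p + 1" "0 < p + 1"
      using ml_R_multi[of E] E V by auto
    have "R_multi D E ((x # replicate p y)[0 := \<Sum>F | mnorm F = q. cscale (g F) (R_multi D F (x # replicate q y))]) =
        (\<Sum>F | mnorm F = q. R_multi D E ((x # replicate p y)[0 := cscale (g F) (R_multi D F (x # replicate q y))]))"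
      by (rule ml_sum_entry[OF E']) (intro V_closed RV, simp)
    also have "\<dots> = (\<Sum>F | mnorm F = q. cscale (g F) (?R (E @ F)))"
    proof (rule sum.cong[OF refl])
      fix F assume F: "F \<in> {F. mnorm F = q}"
      then have "R_multi D E ((x # replicate p y)[0 := cscale (g F) (R_multi D F (x # replicate q y))]) =
          cscale (g F) (R_multi D E ((x # replicate p y)[0 := R_multi D F (x # replicate q y)]))"
        by (intro ml_cscale_entry[OF E'] RV) simp
      also have "R_multi D E ((x # replicate p y)[0 := R_multi D F (x # replicate q y)]) = ?R (E @ F)"
        using R_multi_append_diag[OF V, of E F] E F by (simp add: mnorm_append)
      finally show "R_multi D E ((x # replicate p y)[0 := cscale (g F) (R_multi D F (x # replicate q y))]) =
          cscale (g F) (?R (E @ F))" .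
    qed
    finally show ?thesis by (simp add: R_comb_def)
  qed
  then have "R_comb f p (R_comb g q (x # replicate q y) # replicate p y) =
      (\<Sum>E | mnorm E = p. \<Sum>F | mnorm F = q. cscale (f E * g F) (?R (E @ F)))"
    by (simp add: R_comb_def[of f] vfield.scale_sum_right)
  also have "\<dots> = (\<Sum>(E, F)\<in>{E. mnorm E = p} \<times> {F. mnorm F = q}. cscale (f E * g F) (?R (E @ F)))"
    by (rule sum.cartesian_product)
  \<comment> \<open>A pair (E, F) is the same as its concatenation G with the cut position t =
    \<open>length E\<close>; summing over t gives the convolution.\<close>
  also have "\<dots> = (\<Sum>(G, t)\<in>(SIGMA G:{G. mnorm G = p + q}. {t. t \<le> length G \<and> mnorm (take t G) = p \<and> mnorm (drop t G) = q}).
      cscale (f (take t G) * g (drop t G)) (?R G))"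
    by (rule sum.reindex_bij_witness[where i = "\<lambda>(G, t). (take t G, drop t G)" and
          j = "\<lambda>(E, F). (E @ F, length E)"]) (auto simp: mnorm_append)
  also have "\<dots> = (\<Sum>G | mnorm G = p + q. \<Sum>t | t \<le> length G \<and> mnorm (take t G) = p \<and> mnorm (drop t G) = q.
      cscale (f (take t G) * g (drop t G)) (?R G))"
    by (rule sum.Sigma[symmetric]) (auto simp: finite_mnorm)
  also have "\<dots> = (\<Sum>G | mnorm G = p + q. cscale (conv (graded_part p f) (graded_part q g) G) (?R G))"
  proof (rule sum.cong[OF refl])
    fix G
    let ?S = "{t. t \<le> length G \<and> mnorm (take t G) = p \<and> mnorm (drop t G) = q}"
    have "conv (graded_part p f) (graded_part q g) G = (\<Sum>t\<in>?S. f (take t G) * g (drop t G))"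
      unfolding conv_eq_sum
      by (rule sum.mono_neutral_cong_right) (auto simp: graded_part_def)
    then show "(\<Sum>t\<in>?S. cscale (f (take t G) * g (drop t G)) (?R G)) = cscale (conv (graded_part p f) (graded_part q g) G) (?R G)"
      by (simp add: vfield.scale_sum_left)
  qed
  finally show ?thesis by (simp only: R_comb_def)
qed

lemma represents_wedge1:
  assumes A: "represents p f A" "symmetric_tail p A" "p \<ge> 1" and B: "represents q g B"
  shows "represents (p + q) (conv (graded_part p f) (graded_part q g)) (wedge1 q (tscale (of_nat p) A) B)"
proof -
  have mlA: "ml (p + 1) A" "diag_null (p + 1) A" and mlB: "ml (q + 1) B" "diag_null (q + 1) B"
    using A B by (auto simp: represents_def)
  have "wedge1 q (tscale (of_nat p) A) B (x # replicate (p + q) y) =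
      R_comb (conv (graded_part p f) (graded_part q g)) (p + q) (x # replicate (p + q) y)" if V: "x \<in> V" "y \<in> V" for x y
  proof -
    have "B (x # replicate q y) \<in> V" using V by (intro ml_value[OF mlB(1)]) auto
    then show ?thesis
      using wedge1_diag[OF mlA(1) A(2) mlA(2) A(3) mlB V] A B V R_comb_conv[OF V, of f p g q]
      by (simp add: represents_def diag_eq_def)
  qed
  moreover have "ml (Suc (p + q)) (wedge1 q (tscale (of_nat p) A) B)"
    using ml_wedge1[OF ml_tscale[OF mlA(1)] mlB(1) A(3)] by simp
  moreover have "diag_null (Suc (p + q)) (wedge1 q (tscale (of_nat p) A) B)"
  proof -
    obtain p' where "p = Suc p'" using A(3) by (cases p) auto
    then show ?thesis using wedge1_diag_null[of "p' + q"] by simp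
  qed
  ultimately show ?thesis
    by (simp add: represents_def diag_eq_def)
qed

end

section \<open>Symmetrization\<close>

lemma permute_list_update:
  assumes "\<pi> permutes {..<length Ys}" "i < length Ys"
  shows "permute_list \<pi> (Ys[i := U]) = (permute_list \<pi> Ys)[inv \<pi> i := U]"
proof (rule nth_equalityI)
  fix j assume "j < length (permute_list \<pi> (Ys[i := U]))"
  then have j: "j < length Ys" by simp
  have "\<pi> j < length Ys" using permutes_in_image[OF assms(1), of j] j by simp
  moreover have "\<pi> j = i \<longleftrightarrow> inv \<pi> i = j"
    using permutes_inverses[OF assms(1)] by metis
  ultimately show "permute_list \<pi> (Ys[i := U]) ! j = (permute_list \<pi> Ys)[inv \<pi> i := U] ! j"
    using j assms by (auto simp: permute_list_nth nth_list_update)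
qed simp

text \<open>Entry r \<ge> 2 of \<open>x # Ys\<close> is \<open>Ys ! (r - 2)\<close>, so conjugation
  with the shift by 2 matches the permutations of {2..k+1} with those of {..<k}.\<close>

lemma Sym_Cons:
  assumes "length Ys = k"
  shows "Sym {2..k+1} A (x # Ys) = (\<Sum>\<pi> | \<pi> permutes {..<k}. A (x # permute_list \<pi> Ys))"
proof -
  let ?lift = "\<lambda>\<pi> r. if r \<in> {2..k+1} then \<pi> (r - 2) + 2 else r"
  let ?low = "\<lambda>\<sigma> i. if i \<in> {..<k} then \<sigma> (i + 2) - 2 else i"
  have bij: "bij_betw (\<lambda>i. i + 2) {..<k} {2..k+1}"
    by (rule bij_betwI[where g = "\<lambda>r. r - 2"]) auto
  have bij': "bij_betw (\<lambda>r. r - 2) {2..k+1} {..<k}"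
    by (rule bij_betwI[where g = "\<lambda>i. i + 2"]) auto
  have lift: "?lift \<pi> permutes {2..k+1}" if "\<pi> permutes {..<k}" for \<pi>
  proof (rule bij_imp_permutes)
    have "bij_betw ((\<lambda>i. i + 2) \<circ> (\<pi> \<circ> (\<lambda>r. r - 2))) {2..k+1} {2..k+1}"
      using bij_betw_trans[OF bij_betw_trans[OF bij' permutes_imp_bij[OF that]] bij] by (simp add: o_assoc)
    then show "bij_betw (?lift \<pi>) {2..k+1} {2..k+1}"
      by (rule bij_betw_cong[THEN iffD1, rotated]) auto
  qed auto
  have low: "?low \<sigma> permutes {..<k}" if "\<sigma> permutes {2..k+1}" for \<sigma>
  proof (rule bij_imp_permutes)
    have "bij_betw ((\<lambda>r. r - 2) \<circ> (\<sigma> \<circ> (\<lambda>i. i + 2))) {..<k} {..<k}"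
      using bij_betw_trans[OF bij_betw_trans[OF bij permutes_imp_bij[OF that]] bij'] by (simp add: o_assoc)
    then show "bij_betw (?low \<sigma>) {..<k} {..<k}"
      by (rule bij_betw_cong[THEN iffD1, rotated]) auto
  qed auto
  have A: "A (map (\<lambda>r. entry (x # Ys) (\<sigma> r)) [1..<length (x # Ys) + 1]) = A (x # permute_list (?low \<sigma>) Ys)"
    if \<sigma>: "\<sigma> permutes {2..k+1}" for \<sigma>
  proof -
    have "map (\<lambda>r. entry (x # Ys) (\<sigma> r)) [1..<length (x # Ys) + 1] = x # permute_list (?low \<sigma>) Ys"
    proof (rule nth_equalityI)
      fix i assume "i < length (map (\<lambda>r. entry (x # Ys) (\<sigma> r)) [1..<length (x # Ys) + 1])"
      then have i: "i < k + 1" using assms by (simp del: upt_Suc)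
      show "map (\<lambda>r. entry (x # Ys) (\<sigma> r)) [1..<length (x # Ys) + 1] ! i = (x # permute_list (?low \<sigma>) Ys) ! i"
      proof (cases i)
        case 0
        have "\<sigma> 1 = 1" using permutes_not_in[OF \<sigma>, of 1] by simp
        then show ?thesis using 0 assms by (simp add: entry_def del: upt_Suc)
      next
        case (Suc j)
        then have "\<sigma> (j + 2) \<in> {2..k+1}"
          using permutes_in_image[OF \<sigma>, of "j + 2"] i by simp
        then obtain s where "\<sigma> (j + 2) = s + 2" by (metis add.commute atLeastAtMost_iff le_Suc_ex)
        then show ?thesis
          using Suc i assms by (simp add: entry_def permute_list_def numeral_eq_Suc del: upt_Suc)
      qed
    qed (use assms in simp)
    then show ?thesis by simp
  qed
  have "Sym {2..k+1} A (x # Ys) = (\<Sum>\<sigma> | \<sigma> permutes {2..k+1}. A (x # permute_list (?low \<sigma>) Ys))"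
    unfolding Sym_def by (intro sum.cong refl A) simp
  also have "\<dots> = (\<Sum>\<pi> | \<pi> permutes {..<k}. A (x # permute_list \<pi> Ys))"
  proof (rule sum.reindex_bij_witness[where i = ?lift and j = ?low])
    fix \<sigma> assume "\<sigma> \<in> {\<sigma>. \<sigma> permutes {2..k+1}}"
    then have \<sigma>: "\<sigma> permutes {2..k+1}" by simp
    show "?lift (?low \<sigma>) = \<sigma>"
    proof
      fix r show "?lift (?low \<sigma>) r = \<sigma> r"
      proof (cases "r \<in> {2..k+1}")
        case True
        then have "\<sigma> r \<in> {2..k+1}" using permutes_in_image[OF \<sigma>] by blast
        with True show ?thesis by (auto simp: numeral_eq_Suc Suc_diff_Suc)
      qed (use permutes_not_in[OF \<sigma>] in auto)
    qed
    show "?low \<sigma> \<in> {\<pi>. \<pi> permutes {..<k}}" using low[OF \<sigma>] by simp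
  next
    fix \<pi> assume "\<pi> \<in> {\<pi>. \<pi> permutes {..<k}}"
    then have \<pi>: "\<pi> permutes {..<k}" by simp
    show "?low (?lift \<pi>) = \<pi>"
      using permutes_not_in[OF \<pi>] by auto
    show "?lift \<pi> \<in> {\<sigma>. \<sigma> permutes {2..k+1}}" using lift[OF \<pi>] by simp
  qed simp
  finally show ?thesis .
qed

context charted
begin

lemma ml_Sym:
  assumes A: "ml (k + 1) A" and x: "x \<in> V"
  shows "ml k (\<lambda>Ys. Sym {2..k+1} A (x # Ys))"
proof -
  have "ml k (\<lambda>Ys. \<Sum>\<pi> | \<pi> permutes {..<k}. A (x # permute_list \<pi> Ys))"
  proof (rule ml_sum)
    fix \<pi> assume "\<pi> \<in> {\<pi>. \<pi> permutes {..<k}}"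
    then have \<pi>: "\<pi> permutes {..<k}" by simp
    have Ax: "ml k (\<lambda>Ys. A (x # Ys))" using ml_Cons A x by simp
    have perm: "permute_list \<pi> Ys \<in> lists V" if "Ys \<in> lists V" "length Ys = k" for Ys
      using that \<pi> by (simp add: in_lists_conv_set set_permute_list)
    show "ml k (\<lambda>Ys. A (x # permute_list \<pi> Ys))"
    proof (rule mlI)
      fix Ys assume Ys: "Ys \<in> lists V" "length Ys = k"
      then show "A (x # permute_list \<pi> Ys) \<in> V"
        using perm by (intro ml_value[OF Ax]) auto
      fix i c S T assume i: "i < k" and ST: "S \<in> V" "T \<in> V"
      have "inv \<pi> i < k" using permutes_in_image[OF permutes_inv[OF \<pi>], of i] i by simp
      then show "A (x # permute_list \<pi> (Ys[i := cscale c S + T])) =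
          cscale c (A (x # permute_list \<pi> (Ys[i := S]))) + A (x # permute_list \<pi> (Ys[i := T]))"
        using ml_update[OF Ax perm[OF Ys], of "inv \<pi> i" S T c] Ys i ST \<pi> by (simp add: permute_list_update)
    qed
  qed
  then show ?thesis
    by (rule ml_cong) (rule Sym_Cons)
qed

text \<open>A rearrangement of the tail is absorbed by left composition in the sum over all
  permutations.\<close>

lemma Sym_symmetric_tail: "symmetric_tail k (Sym {2..k+1} A)"
  unfolding symmetric_tail_def
proof (intro ballI allI impI)
  fix X Ys and Zs :: "'a vfield list" assume len: "length Ys = k" and mset: "mset Ys = mset Zs"
  then have len': "length Zs = k" using mset_eq_length by metis
  from mset obtain \<rho> where \<rho>: "\<rho> permutes {..<length Zs}" "permute_list \<rho> Zs = Ys"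
    by (rule mset_eq_permutation)
  have "(\<Sum>\<pi> | \<pi> permutes {..<k}. A (X # permute_list \<pi> Ys)) =
      (\<Sum>\<pi> | \<pi> permutes {..<k}. A (X # permute_list (\<rho> \<circ> \<pi>) Zs))"
  proof (rule sum.cong[OF refl])
    fix \<pi> assume "\<pi> \<in> {\<pi>. \<pi> permutes {..<k}}"
    then show "A (X # permute_list \<pi> Ys) = A (X # permute_list (\<rho> \<circ> \<pi>) Zs)"
      using \<rho> len' permute_list_compose[of \<pi> Zs \<rho>] by auto
  qed
  also have "\<dots> = (\<Sum>\<pi> | \<pi> permutes {..<k}. A (X # permute_list \<pi> Zs))"
  proof -
    have "\<rho> permutes {..<k}" using \<rho>(1) len' by simp
    then show ?thesis
      by (rule setum_permutations_compose_left[symmetric])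
  qed
  finally show "Sym {2..k+1} A (X # Ys) = Sym {2..k+1} A (X # Zs)"
    by (simp only: Sym_Cons[OF len] Sym_Cons[OF len'])
qed

lemma Sym_diag: "Sym {2..k+1} A (x # replicate k y) = cscale (fact k) (A (x # replicate k y))"
proof -
  have "permute_list \<pi> (replicate k y) = replicate k y" if "\<pi> permutes {..<k}" for \<pi>
  proof (rule nth_equalityI)
    fix i assume "i < length (permute_list \<pi> (replicate k y))"
    then show "permute_list \<pi> (replicate k y) ! i = replicate k y ! i"
      using permutes_in_image[OF that, of i] that by (simp add: permute_list_nth)
  qed simp
  then have "Sym {2..k+1} A (x # replicate k y) = (\<Sum>\<pi> | \<pi> permutes {..<k}. A (x # replicate k y))"
    unfolding Sym_Cons[OF length_replicate] by simp
  also have "\<dots> = cscale (of_nat (card {\<pi>. \<pi> permutes {..<k}})) (A (x # replicate k y))"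
    by (rule vfield.sum_constant_scale)
  finally show ?thesis by (simp add: card_permutations)
qed

text \<open>For fixed x the difference of the two sides is symmetric and multilinear in the other k
  entries, so by polarization it is enough to look at (x, y, ..., y), where \<open>Sym\<close> is
  multiplication by k!.\<close>

lemma tensor_eq_Sym_iff:
  assumes F: "ml (k + 1) F" "symmetric_tail k F" and G: "ml (k + 1) G"
  shows "tensor_eq n \<A> (k + 1) F (tscale a (Sym {2..k+1} G)) \<longleftrightarrow>
    diag_eq k F (\<lambda>Xs. cscale (a * fact k) (G Xs))"
proof
  assume L: "tensor_eq n \<A> (k + 1) F (tscale a (Sym {2..k+1} G))"
  show "diag_eq k F (\<lambda>Xs. cscale (a * fact k) (G Xs))"
    unfolding diag_eq_def
  proof (intro ballI)
    fix x y assume "x \<in> V" "y \<in> V"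
    then have "F (x # replicate k y) = tscale a (Sym {2..k+1} G) (x # replicate k y)"
      using L unfolding tensor_eq_def by (simp add: in_lists_conv_set)
    then show "F (x # replicate k y) = cscale (a * fact k) (G (x # replicate k y))"
      unfolding tscale_def Sym_diag by simp
  qed
next
  assume R: "diag_eq k F (\<lambda>Xs. cscale (a * fact k) (G Xs))"
  show "tensor_eq n \<A> (k + 1) F (tscale a (Sym {2..k+1} G))"
    unfolding tensor_eq_def
  proof (intro ballI impI)
    fix Xs assume "Xs \<in> lists V" "length Xs = k + 1"
    then obtain x Ys where Xs: "Xs = x # Ys" "x \<in> V" "Ys \<in> lists V" "length Ys = k"
      by (cases Xs) auto
    let ?H = "\<lambda>Ys. F (x # Ys) - cscale a (Sym {2..k+1} G (x # Ys))"
    have "?H Ys = 0"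
    proof (rule symmetric_ml_polarization[of k ?H])
      show "ml k ?H"
        using F(1) G Xs(2) by (intro ml_diff ml_cscale ml_Sym ml_Cons) simp_all
      show "?H (replicate k y) = 0" if "y \<in> V" for y
        using diag_eqD[OF R Xs(2) that] unfolding Sym_diag by simp
      show "?H Us = ?H Ws" if "Us \<in> lists V" "length Us = k" "mset Us = mset Ws" for Us Ws
        using F(2) Sym_symmetric_tail[of k G] Xs(2) that unfolding symmetric_tail_def by metis
    qed (use Xs in auto)
    then show "F Xs = tscale a (Sym {2..k+1} G) Xs"
      by (simp add: Xs tscale_def)
  qed
qed

lemma on_fields_ml:
  assumes "smooth_tensor n \<A> m S"
  shows "ml m (on_fields S)"
proof (rule mlI)
  fix Xs assume Xs: "Xs \<in> lists V" "length Xs = m"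
  then show "on_fields S Xs \<in> V" using assms by (simp add: smooth_tensor_def)
  fix i c X Y assume i: "i < m" and XY: "X \<in> V" "Y \<in> V"
  have ct: "Z p \<in> ctangent_space n \<A> p" if "Z \<in> V" for Z p
    using that by (simp add: vfields_def)
  show "on_fields S (Xs[i := cscale c X + Y]) = cscale c (on_fields S (Xs[i := X])) + on_fields S (Xs[i := Y])"
  proof
    fix p
    let ?us = "map (\<lambda>X. X p) (take i Xs)" and ?ws = "map (\<lambda>X. X p) (drop (Suc i) Xs)"
    have map: "map (\<lambda>X. X p) (Xs[i := U]) = ?us @ U p # ?ws" for U
      using i Xs by (simp add: upd_conv_take_nth_drop)
    have "?us \<in> lists (ctangent_space n \<A> p)" "?ws \<in> lists (ctangent_space n \<A> p)"
      using Xs ct by (auto simp: in_lists_conv_set dest!: in_set_takeD in_set_dropD)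
    moreover have "length ?us + 1 + length ?ws = m" using i Xs by simp
    ultimately have "S p (?us @ (vscale c (X p) + Y p) # ?ws) =
        vscale c (S p (?us @ X p # ?ws)) + S p (?us @ Y p # ?ws)"
      using assms ct[OF XY(1)] ct[OF XY(2)] unfolding smooth_tensor_def by blast
    then show "on_fields S (Xs[i := cscale c X + Y]) p = (cscale c (on_fields S (Xs[i := X])) + on_fields S (Xs[i := Y])) p"
      by (simp add: on_fields_def map plus_fun_apply fscale_def)
  qed
qed

lemma on_fields_symmetric:
  assumes "smooth_sym_tensor n \<A> k S"
  shows "symmetric_tail k (on_fields S)"
  unfolding symmetric_tail_def
proof (intro ballI allI impI)
  fix X Ys Zs assume *: "X \<in> V" "Ys \<in> lists V" "length Ys = k" "mset Ys = mset Zs"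
  have ct: "Z p \<in> ctangent_space n \<A> p" if "Z \<in> V" for Z p
    using that by (simp add: vfields_def)
  have "set Zs = set Ys" using *(4) mset_eq_setD by metis
  show "on_fields S (X # Ys) = on_fields S (X # Zs)"
  proof
    fix p
    let ?ev = "map (\<lambda>X::'a vfield. X p)"
    have "?ev Ys \<in> lists (ctangent_space n \<A> p)" "?ev Zs \<in> lists (ctangent_space n \<A> p)"
      using * ct \<open>set Zs = set Ys\<close> by (auto simp: in_lists_conv_set)
    moreover have "mset (?ev Ys) = mset (?ev Zs)" using *(4) by simp
    ultimately have "S p (X p # ?ev Ys) = S p (X p # ?ev Zs)"
      using assms ct[OF *(1)] *(3) unfolding smooth_sym_tensor_def by (metis length_map)
    then show "on_fields S (X # Ys) p = on_fields S (X # Zs) p"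
      by (simp add: on_fields_def)
  qed
qed

end

section \<open>The tensors Theta_k and the equivalence\<close>

lemma mnorm_eq_2_iff: "mnorm E = 2 \<longleftrightarrow> E = [0]"
  by (cases E) auto

lemma delta_pow_scale: "(delta ^^ j) (\<lambda>A. c * f A) = (\<lambda>A. c * (delta ^^ j) f A)"
  by (induction j) (simp_all add: delta_scale)

context connection
begin

text \<open>Half of C_A for A = (0) is -1, the sign by which R^A(x, y, y) = R(y, x) y differs from
  R(x, y) y.\<close>

lemma represents_curvature: "represents 2 (\<lambda>A. 1 / 2 * graded_part 2 coeff_CA A) (curvature D)"
proof -
  have "curvature D (x # replicate 2 y) = R_comb (\<lambda>A. 1 / 2 * graded_part 2 coeff_CA A) 2 (x # replicate 2 y)"
    if V: "x \<in> V" "y \<in> V" for x y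
  proof -
    have "{E. mnorm E = 2} = {[0]}" by (auto simp: mnorm_eq_2_iff)
    then have "R_comb (\<lambda>A. 1 / 2 * graded_part 2 coeff_CA A) 2 (x # replicate 2 y) = cscale (- 1) (R_multi D [0] (x # replicate 2 y))"
      unfolding R_comb_def by (simp add: graded_part_def coeff_CA_0)
    also have "R_multi D [0] (x # replicate 2 y) = curvature D [y, x, y]"
      using R_multi_Cons_diag[of D 0 "[]" x y]
      by (simp add: R_multi_Nil nabla_curv_def numeral_2_eq_2 del: curvature.simps)
    also have "cscale (- 1) (curvature D [y, x, y]) = curvature D [x, y, y]"
    proof -
      have "D (D x y - D y x) y = - D (D y x - D x y) y"
        using D_linear_left[of "D y x - D x y" 0 y "- 1"] D_linear_left[of 0 0 y "- 1"] V by (simp add: V_closed D_V)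
      then show ?thesis using V by (simp add: curvature_eq del: curvature.simps)
    qed
    finally show ?thesis by (simp add: numeral_eq_Suc del: curvature.simps)
  qed
  moreover have "curvature D (replicate 3 y) = 0" if "y \<in> V" for y
    using nabla_curv_diag_zero[OF that, of 0] by (simp add: nabla_curv_def)
  ultimately show ?thesis
    using ml_curvature by (simp add: represents_def diag_null_def diag_eq_def numeral_3_eq_3 del: replicate_Suc)
qed

text \<open>This has \<open>del\<close> and not \<open>delta\<close> because no \<open>id1\<close>
  is applied yet. The factor -2 i in Theta_k supplies both the missing -i and the 2, so on (x, y,
  ..., y) that term acts like \<open>id1\<close> applied to 2 R.\<close>

lemma represents_swap_nabla_curvature:
  "represents 3 (\<lambda>A. 1 / 2 * del (graded_part 2 coeff_CA) A) (swap12 (nabla D (curvature D)))"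
proof -
  have c: "ml (Suc 2) (curvature D)" "diag_null (Suc 2) (curvature D)"
    using represents_curvature by (auto simp: represents_def)
  have "nabla D (curvature D) (x # replicate (Suc 2) y) = 0" if "x \<in> V" "y \<in> V" for x y
    using nabla_diag_zero[OF c(1) _ that] c(2) unfolding diag_null_def by blast
  then have "diag_null (Suc 3) (swap12 (nabla D (curvature D)))"
    by (simp add: diag_null_def numeral_eq_Suc del: nabla.simps)
  moreover have "ml (Suc 3) (swap12 (nabla D (curvature D)))"
    using ml_swap12[of 2] ml_nabla[OF c(1)] by (simp add: numeral_eq_Suc)
  moreover have "diag_eq 3 (swap12 (nabla D (curvature D))) (R_comb (\<lambda>A. 1 / 2 * del (graded_part 2 coeff_CA) A) 3)"
  proof -
    have "del (\<lambda>A. 1 / 2 * graded_part 2 coeff_CA A) = (\<lambda>A. 1 / 2 * del (graded_part 2 coeff_CA) A)"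
      by (rule ext) (rule del_scale)
    moreover have "Suc 2 = 3" by simp
    ultimately show ?thesis
      using represents_swapped_nabla[OF represents_curvature] by (simp only: swapped_nabla_def)
  qed
  ultimately show ?thesis by (simp add: represents_def)
qed

lemma Theta_eq:
  "k \<noteq> 2 \<Longrightarrow> Theta D S k = tscale (- 2 * \<i>) ((id1 D ^^ (k - 3)) (swap12 (nabla D (curvature D)))) +
    (\<Sum>r = 3..k-1. tscale (fact (r + 1)) (\<Sum>p = 2..r-1.
      (id1 D ^^ (k - 1 - r)) (wedge1 (r - p + 1) (tscale (of_nat p) (on_fields (S p))) (on_fields (S (r - p + 1))))))"
  by (simp add: Theta_def)

lemma ml_plus: "ml m A \<Longrightarrow> ml m B \<Longrightarrow> ml m (A + B)"
  using ml_add[of m A B] by (simp add: plus_fun_def[of A B])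

lemma ml_sum_fun:
  assumes "\<And>i. i \<in> I \<Longrightarrow> ml m (A i)"
  shows "ml m (\<Sum>i\<in>I. A i)"
proof -
  have "(\<Sum>i\<in>I. A i) = (\<lambda>Xs. \<Sum>i\<in>I. A i Xs)" by (simp add: fun_eq_iff sum_apply)
  then show ?thesis using ml_sum[of I m A] assms by simp
qed

lemma ml_R_combheta:
  assumes S: "\<And>j. j \<ge> 2 \<Longrightarrow> smooth_sym_tensor n \<A> j (S j)" and k: "k \<ge> 2"
  shows "ml (k + 1) (Theta D S k)"
proof (cases "k = 2")
  case True
  then show ?thesis
    using ml_tscale[OF ml_curvature] by (simp add: Theta_def numeral_eq_Suc)
next
  case False
  then have k: "k \<ge> 3" using k by simp
  have "ml (Suc k) ((id1 D ^^ (k - 3)) (swap12 (nabla D (curvature D))))"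
    using ml_id1_pow[of 3 _ "k - 3"] represents_swap_nabla_curvature k by (simp add: represents_def)
  moreover have "ml (Suc k) ((id1 D ^^ (k - 1 - r))
      (wedge1 (r - p + 1) (tscale (of_nat p) (on_fields (S p))) (on_fields (S (r - p + 1)))))"
    if r: "r \<in> {3..k-1}" and p: "p \<in> {2..r-1}" for r p
  proof -
    let ?q = "r - p + 1"
    have "smooth_tensor n \<A> (p + 1) (S p)" "smooth_tensor n \<A> (?q + 1) (S ?q)"
      using S[of p] S[of ?q] r p by (auto simp: smooth_sym_tensor_def)
    then have "ml (p + ?q + 1) (wedge1 ?q (tscale (of_nat p) (on_fields (S p))) (on_fields (S ?q)))"
      using p by (intro ml_wedge1 ml_tscale on_fields_ml) auto
    \<comment> \<open>The wedge has r + 2 entries, and k - 1 - r applications of \<open>id1\<close>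
      bring their number to k + 1.\<close>
    moreover have "p + ?q + 1 = Suc (r + 1)" using r p by auto
    ultimately have "ml (Suc (r + 1)) (wedge1 ?q (tscale (of_nat p) (on_fields (S p))) (on_fields (S ?q)))"
      by (simp only:)
    then have "ml (Suc (r + 1 + (k - 1 - r)))
        ((id1 D ^^ (k - 1 - r)) (wedge1 ?q (tscale (of_nat p) (on_fields (S p))) (on_fields (S ?q))))"
      by (rule ml_id1_pow)
    moreover have "r + 1 + (k - 1 - r) = k" using r by auto
    ultimately show ?thesis by simp
  qed
  ultimately show ?thesis
    unfolding Theta_eq[OF False] Suc_eq_plus1 by (intro ml_plus ml_sum_fun ml_tscale)
qed

text \<open>Only S_p and S_q with p, q \<le> k - 2 occur in Theta_k, so the hypothesis on lower
  degrees reaches all of them. Each operation is replaced by its counterpart on coefficients, and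
  the outcome is the unrolled recursion for C_A.\<close>

lemma represents_Theta:
  assumes S: "\<And>j. j \<ge> 2 \<Longrightarrow> smooth_sym_tensor n \<A> j (S j)"
    and rep: "\<And>j. 2 \<le> j \<Longrightarrow> j < k \<Longrightarrow> diag_eq j (on_fields (S j)) (R_comb coeff_S j)" and k: "k \<ge> 2"
  shows "represents k (graded_part k coeff_CA) (Theta D S k)"
proof (cases "k = 2")
  case True
  have "represents 2 (\<lambda>E. 2 * (1 / 2 * graded_part 2 coeff_CA E)) (tscale 2 (curvature D))"
    by (rule represents_tscale[OF represents_curvature])
  then show ?thesis using True by (simp add: Theta_def)
next
  case False
  then have k: "k \<ge> 3" using k by simp
  have repS: "represents j coeff_S (on_fields (S j))" if "2 \<le> j" "j < k" for j
  proof -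
    have "ml (Suc j) (on_fields (S j))"
      using S[OF that(1)] on_fields_ml by (simp add: smooth_sym_tensor_def)
    moreover have "diag_null (Suc j) (on_fields (S j))"
      using diag_eq_null[OF rep[OF that] R_comb_diag_null] that by simp
    ultimately show ?thesis using rep[OF that] by (simp add: represents_def)
  qed
  let ?X = "swap12 (nabla D (curvature D))"
  have "represents (3 + (k - 3)) ((delta ^^ (k - 3)) (\<lambda>A. 1 / 2 * del (graded_part 2 coeff_CA) A)) ((id1 D ^^ (k - 3)) ?X)"
    by (rule represents_id1_pow[OF represents_swap_nabla_curvature])
  then have "represents k (\<lambda>E. - 2 * \<i> * (delta ^^ (k - 3)) (\<lambda>A. 1 / 2 * del (graded_part 2 coeff_CA) A) E)
      (tscale (- 2 * \<i>) ((id1 D ^^ (k - 3)) ?X))"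
    using k by (intro represents_tscale) simp
  moreover have "(\<lambda>E. - 2 * \<i> * (delta ^^ (k - 3)) (\<lambda>A. 1 / 2 * del (graded_part 2 coeff_CA) A) E) =
      (delta ^^ (k - 3)) (delta (graded_part 2 coeff_CA))"
    unfolding delta_def[of "graded_part 2 coeff_CA"] delta_pow_scale by simp
  ultimately have 1: "represents k ((delta ^^ (k - 3)) (delta (graded_part 2 coeff_CA))) (tscale (- 2 * \<i>) ((id1 D ^^ (k - 3)) ?X))"
    by simp
  have "represents k ((delta ^^ (k - 1 - r)) (conv (graded_part p coeff_S) (graded_part (r - p + 1) coeff_S)))
      ((id1 D ^^ (k - 1 - r)) (wedge1 (r - p + 1) (tscale (of_nat p) (on_fields (S p))) (on_fields (S (r - p + 1)))))"
    if r: "r \<in> {3..k-1}" and p: "p \<in> {2..r-1}" for r p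
  proof -
    let ?q = "r - p + 1"
    have "represents (p + ?q) (conv (graded_part p coeff_S) (graded_part ?q coeff_S))
        (wedge1 ?q (tscale (of_nat p) (on_fields (S p))) (on_fields (S ?q)))"
      using r p by (intro represents_wedge1 repS on_fields_symmetric S) auto
    moreover have "p + ?q + (k - 1 - r) = k" using r p by auto
    ultimately show ?thesis using represents_id1_pow by metis
  qed
  then have "represents k (\<lambda>E. (delta ^^ (k - 3)) (delta (graded_part 2 coeff_CA)) E +
      (\<Sum>r=3..k-1. fact (r + 1) * (\<Sum>p=2..r-1. (delta ^^ (k - 1 - r)) (conv (graded_part p coeff_S) (graded_part (r - p + 1) coeff_S)) E)))
      (Theta D S k)"
    unfolding Theta_eq[OF False] by (intro represents_add 1 represents_sum represents_tscale)
  then show ?thesis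
    using graded_part_coeff_CA_unrolled[OF k] by simp
qed

end

theorem theorem1p6:
  fixes n :: nat
    and \<A> :: "'a::{t2_space, second_countable_topology} chart set"
    and D :: "'a vfield \<Rightarrow> 'a vfield \<Rightarrow> 'a vfield"
    and S :: "nat \<Rightarrow> 'a \<Rightarrow> 'a cvec list \<Rightarrow> 'a cvec"
  assumes "smooth_manifold n \<A>"
    and "complex_covariant_derivative n \<A> D"
    and "torsion_free n \<A> D"
    and "\<forall>k\<ge>2. smooth_sym_tensor n \<A> k (S k)"
  shows
    "(\<forall>k\<ge>2. tensor_eq n \<A> (k + 1) (on_fields (S k))
        (tscale (\<i> / (fact (k + 1) * fact k)) (Sym {2..k+1} (Theta D S k))))
     \<longleftrightarrow>
     (\<forall>k\<ge>2. tensor_eq n \<A> (k + 1) (on_fields (S k))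
        (tscale (\<i> / (fact (k + 1) * fact k))
          (\<Sum>E | E \<noteq> [] \<and> mnorm E = k. tscale (coeff_CA E) (Sym {2..k+1} (R_multi D E)))))"
proof -
  interpret connection n \<A> D
    using assms by unfold_locales
  have S: "smooth_sym_tensor n \<A> j (S j)" if "j \<ge> 2" for j
    using assms(4) that by blast
  let ?F = "\<lambda>k. on_fields (S k)" and ?a = "\<lambda>k. \<i> / (fact (k + 1) * fact k) :: complex"
  have F: "ml (k + 1) (?F k)" "symmetric_tail k (?F k)" if "k \<ge> 2" for k
    using S[OF that] on_fields_ml on_fields_symmetric by (auto simp: smooth_sym_tensor_def)
  \<comment> \<open>One factorial of the prefactor is cancelled by the k! permutations that agree on
    (x, y, ..., y).\<close>
  have a: "?a k * fact k = \<i> / fact (k + 1)" for k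
    by (simp del: fact_Suc)
  have recursion: "tensor_eq n \<A> (k + 1) (?F k) (tscale (?a k) (Sym {2..k+1} (Theta D S k))) \<longleftrightarrow>
      diag_eq k (?F k) (\<lambda>Xs. cscale (\<i> / fact (k + 1)) (Theta D S k Xs))" if "k \<ge> 2" for k
    using tensor_eq_Sym_iff[OF F[OF that] ml_R_combheta[OF S that], of "?a k"] by (simp only: a)
  have closed: "tensor_eq n \<A> (k + 1) (?F k) (tscale (?a k)
        (\<Sum>E | E \<noteq> [] \<and> mnorm E = k. tscale (coeff_CA E) (Sym {2..k+1} (R_multi D E)))) \<longleftrightarrow>
      diag_eq k (?F k) (R_comb coeff_S k)" if k: "k \<ge> 2" for k
  proof -
    have "(\<Sum>E | E \<noteq> [] \<and> mnorm E = k. tscale (coeff_CA E) (Sym {2..k+1} (R_multi D E))) =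
        Sym {2..k+1} (R_comb coeff_CA k)"
    proof
      fix Xs
      \<comment> \<open>The empty list has norm 0, so k \<ge> 2 excludes it already.\<close>
      have "{E. E \<noteq> [] \<and> mnorm E = k} = {E. mnorm E = k}" using k by auto
      then show "(\<Sum>E | E \<noteq> [] \<and> mnorm E = k. tscale (coeff_CA E) (Sym {2..k+1} (R_multi D E))) Xs =
          Sym {2..k+1} (R_comb coeff_CA k) Xs"
        by (simp only: sum_apply tscale_def Sym_def R_comb_def vfield.scale_sum_right) (rule sum.swap)
    qed
    moreover have "R_comb coeff_S k = (\<lambda>Xs. cscale (\<i> / fact (k + 1)) (R_comb coeff_CA k Xs))"
      unfolding R_comb_scale[symmetric] by (simp add: fun_eq_iff R_comb_def coeff_S_def del: fact_Suc)
    ultimately show ?thesis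
      using tensor_eq_Sym_iff[OF F[OF k], of "R_comb coeff_CA k" "?a k"] ml_R_comb[of k coeff_CA] by (simp only: a Suc_eq_plus1)
  qed
  \<comment> \<open>Given the closed formula in lower degrees, the two right hand sides agree on (x,
    y, ..., y), so the two conditions on S_k coincide.\<close>
  have step: "diag_eq k (?F k) (\<lambda>Xs. cscale (\<i> / fact (k + 1)) (Theta D S k Xs)) \<longleftrightarrow> diag_eq k (?F k) (R_comb coeff_S k)"
    if k: "k \<ge> 2" and IH: "\<And>j. 2 \<le> j \<Longrightarrow> j < k \<Longrightarrow> diag_eq j (?F j) (R_comb coeff_S j)" for k
  proof -
    have "diag_eq k (Theta D S k) (R_comb coeff_CA k)"
      using represents_Theta[OF S IH k] by (simp add: represents_def R_comb_graded_part)
    moreover have "R_comb coeff_S k = (\<lambda>Xs. cscale (\<i> / fact (k + 1)) (R_comb coeff_CA k Xs))"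
      unfolding R_comb_scale[symmetric] by (simp add: fun_eq_iff R_comb_def coeff_S_def del: fact_Suc)
    ultimately show ?thesis by (simp add: diag_eq_def del: fact_Suc)
  qed
  have "(\<forall>k\<ge>2. diag_eq k (?F k) (\<lambda>Xs. cscale (\<i> / fact (k + 1)) (Theta D S k Xs))) \<longleftrightarrow>
      (\<forall>k\<ge>2. diag_eq k (?F k) (R_comb coeff_S k))"
  proof
    assume L: "\<forall>k\<ge>2. diag_eq k (?F k) (\<lambda>Xs. cscale (\<i> / fact (k + 1)) (Theta D S k Xs))"
    show "\<forall>k\<ge>2. diag_eq k (?F k) (R_comb coeff_S k)"
    proof (intro allI impI)
      fix k :: nat assume "k \<ge> 2"
      then show "diag_eq k (?F k) (R_comb coeff_S k)"
      \<comment> \<open>Theta_k contains lower S_j, so the closed formula has to be known for them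
        first. In the converse direction it is given in all degrees and \<open>step\<close> applies
        at once.\<close>
      proof (induction k rule: less_induct)
        case (less k)
        then show ?case using step[of k] L by blast
      qed
    qed
  qed (use step in blast)
  then show ?thesis
    using recursion closed by simp
qed

end
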